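(* Let $(\gamma,\nu):I\to\Delta_1$ be a spacelike Legendre curve with curvature $(m,n)$ such that $\{t\in I: n(t)\neq 0\}$ is dense in $I$. (1) Let $s_\pm:I\to\mathbb R$ be a solution of the Riccati equation $\dot s_\pm=\frac{m\pm n}{2}s_\pm^2-m$, let $Inv^\pm(\gamma,s_\pm)$ be the corresponding horocyclic involute, with $\nu_I^\pm$ as in the context, and let $\mathrm{Reg}(\nu_I^\pm)=\{t\in I: n(t)\pm m(t)\neq0\}$ be the set of regular points of $\nu_I^\pm$. If $\mathrm{Reg}(\nu_I^\pm)$ is dense in $I$, then the horocyclic evolute of the horocyclic involute $(Inv^\pm(\gamma,s_\pm),\nu_I^\pm)$ always exists and is unique. Moreover, for all $t\in I$, $$Ev^+\left(Inv^+(\gamma,s_+)\right)(t)=Ev^-\left(Inv^-(\gamma,s_-)\right)(t)=\gamma(t),$$ $$\overline{Ev}^+\left(Inv^-(\gamma,s_-)\right)(t)=\overline{Ev}^-\left(Inv^+(\gamma,s_+)\right)(t)=\gamma(t).$$ (2) Suppose that there exists a smooth function $f:I\to\mathbb R$ such that $m(t)+f(t)n(t)=0$ for all $t\in I$. Then for all $t\in I$ $$Inv^+\left(Ev^+(\gamma),S_E^+\right)(t)=\overline{Inv}^-\left(Ev^+(\gamma),\overline S_E^-\right)(t)=\gamma(t)+(f(t)-S_E^+(t))\nu(t)+\frac{(f(t)-S_E^+(t))^2}{2}(\gamma(t)+\mu(t)),$$ $$Inv^-\left(Ev^-(\gamma),S_E^-\right)(t)=\overline{Inv}^+\left(Ev^-(\gamma),\overline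 S_E^+\right)(t)=\gamma(t)+(f(t)-S_E^-(t))\nu(t)+\frac{(f(t)-S_E^-(t))^2}{2}(\gamma(t)-\mu(t)),$$ where $$S_E^\pm(t)=f(t)\quad\text{or}\quad S_E^\pm(t)=f(t)-\frac{2e^{\mp\int m(t)\,dt}}{\pm\int n(t)e^{\mp\int m(t)\,dt}\,dt+c},\qquad \overline S_E^\pm(t)=-S_E^\mp(t),$$ and $c$ is a constant. Moreover, $Inv^+(Ev^+(\gamma),S_E^+)$, $Inv^-(Ev^-(\gamma),S_E^-)$, $\overline{Inv}^+(Ev^-(\gamma),\overline S_E^+)$ and $\overline{Inv}^-(Ev^+(\gamma),\overline S_E^-)$ are horocyclic parallels of $\gamma$.
   Context: All maps are $C^\infty$; $I\subset\mathbb R$ is an interval; a dot denotes $d/dt$. In every formula with $\pm,\mp$ the upper signs are taken together and the lower signs together. $\mathbb R^3_1$ is $\mathbb R^3$ with $\langle x,y\rangle=-x_1y_1+x_2y_2+x_3y_3$ and $x\wedge y=(-(x_2y_3-x_3y_2),\,x_3y_1-x_1y_3,\,x_1y_2-x_2y_1)$. $H^2=\{x:\langle x,x\rangle=-1,\ x_1>0\}$, $S^2_1=\{x:\langle x,x\rangle=1\}$, $\Delta_1=\{(\nu_1,\nu_2)\in H^2\times S_1^2:\langle\nu_1,\nu_2\rangle=0\}$. A spacelike Legendre curve is a map $(\gamma,\nu):I\to\Delta_1$ with $\langle\dot\gamma,\nu\rangle=0$ on $I$; put $\mu=\gamma\wedge\nu$. Its curvature is the pair $(m,n)$ with $\dot\gamma=m\mu$,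 $\dot\nu=n\mu$ (then $\dot\mu=m\gamma-n\nu$). $(\gamma,-\nu)$ is then a spacelike Legendre curve with curvature $(-m,n)$ and third frame vector $-\mu$. Horocyclic evolute: for any spacelike Legendre curve $(\gamma,\nu)$ with curvature $(m,n)$, the horocyclic evolute exists if there is a smooth $f:I\to\mathbb R$ with $m+fn=0$ on $I$ (it is unique if such $f$ is unique), and then $Ev^\pm(\gamma)=\gamma+f\nu+\frac{f^2}{2}(\gamma\pm\mu)$. The horocyclic evolute of $(\gamma,-\nu)$ is denoted $\overline{Ev}^\pm(\gamma)$. $(Ev^\pm(\gamma),\nu_E^\pm)$ is a spacelike Legendre curve, where $\nu_E^\pm=\mp\frac{f^2}{2}\gamma\mp f\nu+(1-\frac{f^2}{2})\mu$, with curvature $(m_E^\pm,n_E^\pm)=(-\dot f\pm\frac{f^2n}{2},\ \pm\dot f-\frac{f^2n}{2}+n)$. Horocyclic involute: for any spacelike Legendre curve $(\gamma,\nu)$ with curvature $(m,n)$ and a solution $s_\pm:I\to\mathbb R$ of $\dot s_\pm=\frac{m\pm n}{2}s_\pm^2-m$, $Inv^\pm(\gamma,s_\pm)=\gamma+s_\pm\mu+\frac{s_\pm^2}{2}(\gamma\pm\nu)$. The horocyclic involute of $(\gamma,-\nu)$ for a solution $\overline s_\pm$ of the corresponding equation $\dot{\overline s}_\pm=\frac{-m\pm n}{2}\overline s_\pm^2+m$ is denoted $\overline{Inv}^\pm(\gamma,\overline s_\pm)=\gamma+\overline s_\pm(-\mu)+\frac{\overline s_\pm^2}{2}(\gamma\mp\nu)$.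 $(Inv^\pm(\gamma,s_\pm),\nu_I^\pm)$ is a spacelike Legendre curve, where $\nu_I^\pm=-s_\pm\gamma-\mu\mp s_\pm\nu$. $Ev^\pm(Inv^\pm(\gamma,s_\pm))$ and $\overline{Ev}^{\mp}(Inv^\pm(\gamma,s_\pm))$ are the horocyclic evolutes of $(Inv^\pm(\gamma,s_\pm),\nu_I^\pm)$ and $(Inv^\pm(\gamma,s_\pm),-\nu_I^\pm)$, respectively (with the indicated superscript sign). $Inv^\pm(Ev^\pm(\gamma),S)$ and $\overline{Inv}^{\mp}(Ev^\pm(\gamma),\overline S)$ are the horocyclic involutes of $(Ev^\pm(\gamma),\nu_E^\pm)$ and $(Ev^\pm(\gamma),-\nu_E^\pm)$, respectively, so $S_E^\pm$ is a solution on $I$ of $\dot S=\frac{m_E^\pm\pm n_E^\pm}{2}S^2-m_E^\pm$. Indefinite integrals denote fixed antiderivatives on $I$, and $c$ is such that the denominator does not vanish on $I$. Horocyclic parallel of $(\gamma,\nu)$ (or of $\gamma$): $P^\pm(\gamma,\lambda_\pm)=\gamma+\lambda_\pm\nu+\frac{\lambda_\pm^2}{2}(\gamma\pm\mu)$ where $\lambda_\pm:I\to\mathbb R$ is a solution of $\dot\lambda_\pm=\mp(\frac{\lambda_\pm^2n}{2}+\lambda_\pm m)$. *)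

theory Defs
  imports "HOL-Analysis.Analysis"
begin

(* Conventions.  A double sign is a parameter \<sigma> :: real ranging over {1, -1}: \<sigma> = 1 selects
   the upper signs and \<sigma> = -1 the lower ones.  Curves are total functions of which only the
   values on the interval I matter; derivatives are taken within I, hence are one-sided at
   endpoints belonging to I. *)

section \<open>Smooth maps on an interval\<close>

(* C^infinity on I: there is a full sequence of successive derivatives D 0 = g, D 1, D 2, ... on I. *)
definition smooth_on :: "real set \<Rightarrow> (real \<Rightarrow> 'a::real_normed_vector) \<Rightarrow> bool" where
  "smooth_on I g \<longleftrightarrow>
     (\<exists>D :: nat \<Rightarrow> real \<Rightarrow> 'a. (\<forall>t\<in>I. D 0 t = g t) \<and>
        (\<forall>k. \<forall>t\<in>I. (D k has_vector_derivative D (Suc k) t) (at t within I)))"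

section \<open>Lorentz-Minkowski 3-space\<close>

definition lorentz_inner :: "real^3 \<Rightarrow> real^3 \<Rightarrow> real" where
  "lorentz_inner x y = - (x$1 * y$1) + x$2 * y$2 + x$3 * y$3"

definition lorentz_wedge :: "real^3 \<Rightarrow> real^3 \<Rightarrow> real^3" where
  "lorentz_wedge x y = vector [- (x$2 * y$3 - x$3 * y$2), x$3 * y$1 - x$1 * y$3, x$1 * y$2 - x$2 * y$1]"

definition hyperbolic_plane :: "(real^3) set" where
  "hyperbolic_plane = {x. lorentz_inner x x = -1 \<and> x$1 > 0}"

definition de_sitter_space :: "(real^3) set" where
  "de_sitter_space = {x. lorentz_inner x x = 1}"

definition Delta1 :: "((real^3) \<times> (real^3)) set" where
  "Delta1 = {(a, b). a \<in> hyperbolic_plane \<and> b \<in> de_sitter_space \<and> lorentz_inner a b = 0}"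

section \<open>Spacelike Legendre curves\<close>

definition spacelike_legendre_curve ::
  "real set \<Rightarrow> (real \<Rightarrow> real^3) \<Rightarrow> (real \<Rightarrow> real^3) \<Rightarrow> bool" where
  "spacelike_legendre_curve I \<gamma> \<nu> \<longleftrightarrow>
     smooth_on I \<gamma> \<and> smooth_on I \<nu> \<and> (\<forall>t\<in>I. (\<gamma> t, \<nu> t) \<in> Delta1) \<and>
     (\<forall>t\<in>I. lorentz_inner (vector_derivative \<gamma> (at t within I)) (\<nu> t) = 0)"

definition third_frame :: "(real \<Rightarrow> real^3) \<Rightarrow> (real \<Rightarrow> real^3) \<Rightarrow> real \<Rightarrow> real^3" where
  "third_frame \<gamma> \<nu> t = lorentz_wedge (\<gamma> t) (\<nu> t)"

definition legendre_curvature ::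
  "real set \<Rightarrow> (real \<Rightarrow> real^3) \<Rightarrow> (real \<Rightarrow> real^3) \<Rightarrow> (real \<Rightarrow> real) \<Rightarrow> (real \<Rightarrow> real) \<Rightarrow> bool" where
  "legendre_curvature I \<gamma> \<nu> m n \<longleftrightarrow>
     spacelike_legendre_curve I \<gamma> \<nu> \<and> smooth_on I m \<and> smooth_on I n \<and>
     (\<forall>t\<in>I. (\<gamma> has_vector_derivative m t *\<^sub>R third_frame \<gamma> \<nu> t) (at t within I) \<and>
            (\<nu> has_vector_derivative n t *\<^sub>R third_frame \<gamma> \<nu> t) (at t within I))"

section \<open>Horocyclic evolutes\<close>

(* f exhibits the existence of the horocyclic evolute of (\<gamma>, \<nu>). *)
definition evolute_function ::
  "real set \<Rightarrow> (real \<Rightarrow> real^3) \<Rightarrow> (real \<Rightarrow> real^3) \<Rightarrow> (real \<Rightarrow> real) \<Rightarrow> bool" where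
  "evolute_function I \<gamma> \<nu> f \<longleftrightarrow>
     (\<exists>m n. legendre_curvature I \<gamma> \<nu> m n \<and> smooth_on I f \<and> (\<forall>t\<in>I. m t + f t * n t = 0))"

(* The barred objects of (\<gamma>, \<nu>) are those of (\<gamma>, -\<nu>); they are obtained by putting
   \<lambda>t. - \<nu> t for \<nu> here and in horocyclic_involute below. *)
definition horocyclic_evolute ::
  "real \<Rightarrow> (real \<Rightarrow> real^3) \<Rightarrow> (real \<Rightarrow> real^3) \<Rightarrow> (real \<Rightarrow> real) \<Rightarrow> real \<Rightarrow> real^3" where
  "horocyclic_evolute \<sigma> \<gamma> \<nu> f t =
     \<gamma> t + f t *\<^sub>R \<nu> t + ((f t)\<^sup>2 / 2) *\<^sub>R (\<gamma> t + \<sigma> *\<^sub>R third_frame \<gamma> \<nu> t)"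

definition evolute_normal ::
  "real \<Rightarrow> (real \<Rightarrow> real^3) \<Rightarrow> (real \<Rightarrow> real^3) \<Rightarrow> (real \<Rightarrow> real) \<Rightarrow> real \<Rightarrow> real^3" where
  "evolute_normal \<sigma> \<gamma> \<nu> f t =
     (- \<sigma> * ((f t)\<^sup>2 / 2)) *\<^sub>R \<gamma> t - (\<sigma> * f t) *\<^sub>R \<nu> t + (1 - (f t)\<^sup>2 / 2) *\<^sub>R third_frame \<gamma> \<nu> t"

section \<open>Horocyclic involutes\<close>

definition riccati_solution ::
  "real \<Rightarrow> real set \<Rightarrow> (real \<Rightarrow> real) \<Rightarrow> (real \<Rightarrow> real) \<Rightarrow> (real \<Rightarrow> real) \<Rightarrow> bool" where
  "riccati_solution \<sigma> I m n s \<longleftrightarrow> smooth_on I s \<and>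
     (\<forall>t\<in>I. (s has_real_derivative (m t + \<sigma> * n t) / 2 * (s t)\<^sup>2 - m t) (at t within I))"

(* s defines a horocyclic involute of (\<gamma>, \<nu>). *)
definition involute_function ::
  "real \<Rightarrow> real set \<Rightarrow> (real \<Rightarrow> real^3) \<Rightarrow> (real \<Rightarrow> real^3) \<Rightarrow> (real \<Rightarrow> real) \<Rightarrow> bool" where
  "involute_function \<sigma> I \<gamma> \<nu> s \<longleftrightarrow>
     (\<exists>m n. legendre_curvature I \<gamma> \<nu> m n \<and> riccati_solution \<sigma> I m n s)"

definition horocyclic_involute ::
  "real \<Rightarrow> (real \<Rightarrow> real^3) \<Rightarrow> (real \<Rightarrow> real^3) \<Rightarrow> (real \<Rightarrow> real) \<Rightarrow> real \<Rightarrow> real^3" where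
  "horocyclic_involute \<sigma> \<gamma> \<nu> s t =
     \<gamma> t + s t *\<^sub>R third_frame \<gamma> \<nu> t + ((s t)\<^sup>2 / 2) *\<^sub>R (\<gamma> t + \<sigma> *\<^sub>R \<nu> t)"

definition involute_normal ::
  "real \<Rightarrow> (real \<Rightarrow> real^3) \<Rightarrow> (real \<Rightarrow> real^3) \<Rightarrow> (real \<Rightarrow> real) \<Rightarrow> real \<Rightarrow> real^3" where
  "involute_normal \<sigma> \<gamma> \<nu> s t =
     (- s t) *\<^sub>R \<gamma> t - third_frame \<gamma> \<nu> t - (\<sigma> * s t) *\<^sub>R \<nu> t"

section \<open>Horocyclic parallels\<close>

definition is_horocyclic_parallel ::
  "real \<Rightarrow> real set \<Rightarrow> (real \<Rightarrow> real^3) \<Rightarrow> (real \<Rightarrow> real^3) \<Rightarrow> (real \<Rightarrow> real^3) \<Rightarrow> bool" where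
  "is_horocyclic_parallel \<sigma> I \<gamma> \<nu> P \<longleftrightarrow>
     (\<exists>m n l. legendre_curvature I \<gamma> \<nu> m n \<and> smooth_on I l \<and>
        (\<forall>t\<in>I. (l has_real_derivative - \<sigma> * ((l t)\<^sup>2 * n t / 2 + l t * m t)) (at t within I)) \<and>
        (\<forall>t\<in>I. P t = \<gamma> t + l t *\<^sub>R \<nu> t + ((l t)\<^sup>2 / 2) *\<^sub>R (\<gamma> t + \<sigma> *\<^sub>R third_frame \<gamma> \<nu> t)))"

end

(* Everything is expressed in coordinates with respect to the moving frame (gamma, nu, mu), in which
   inner and wedge products have the standard form.  The involute has curvature (- s k, k) with
   k = n + sigma m, so density of {k \<noteq> 0} and continuity force its evolute function to be s, and
   substituting f = s gives back gamma.  The involute of the evolute by S depends on S only through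
   l = f - S, and the Riccati equation for S is the Bernoulli equation of horocyclic parallels for l. *)

theory Submission
  imports Defs
begin

text \<open>At a fixed \<open>t\<close> both constructions move the curve point along a horocycle,
  the orbit of a parabolic group that fixes a null vector: \<open>\<gamma> + \<sigma> \<mu>\<close>
  for the evolute, \<open>\<gamma> + \<sigma> \<nu>\<close> for the involute. The new normals are
  built so that the opposite construction, applied to the new curve, fixes the same null vector and
  runs in the reverse direction. Parameters therefore subtract, which is the source of both
  \<open>f = s\<close> and \<open>f - S\<close>. The Riccati equation for \<open>S\<close> has the
  particular solution \<open>S = f\<close>; subtracting it leaves an equation without constant term.
  Two features of the encoding shape the rest. Smoothness asks for an entire sequence of
  derivatives, so closure properties are obtained from classes of functions closed under
  differentiation rather than from formulas for higher derivatives. The predicates for evolutes,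
  involutes and parallels hide the curvature behind an existential quantifier; the computed
  curvature may replace it only because curvature is unique, and this rests on \<open>I\<close>
  having no isolated point.\<close>

section \<open>Smooth maps on a set\<close>

text \<open>A choice of derivative inside \<open>X\<close> for each member is an operator
  \<open>d\<close> on \<open>X\<close>, and its iterates on \<open>g\<close> form the required
  sequence. A proof of smoothness is thereby reduced to finding a class stable under
  differentiation.\<close>

lemma smooth_on_coinduct:
  assumes "g \<in> X"
    and step: "\<And>h. h \<in> X \<Longrightarrow> \<exists>h'\<in>X. \<forall>t\<in>I. (h has_vector_derivative h' t) (at t within I)"
  shows "smooth_on I g"
proof -
  have "\<forall>h\<in>X. \<exists>h'. h' \<in> X \<and> (\<forall>t\<in>I. (h has_vector_derivative h' t) (at t within I))"
    using step by blast
  then obtain d where d: "\<And>h. h \<in> X \<Longrightarrow> d h \<in> X"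
      "\<And>h t. h \<in> X \<Longrightarrow> t \<in> I \<Longrightarrow> (h has_vector_derivative d h t) (at t within I)"
    by (metis bchoice)
  have X: "(d ^^ k) g \<in> X" for k
    by (induction k) (auto simp: \<open>g \<in> X\<close> d)
  show ?thesis
    unfolding smooth_on_def
    by (intro exI[of _ "\<lambda>k. (d ^^ k) g"]) (auto intro: d X)
qed

lemma smooth_on_derivative:
  assumes "smooth_on I g"
  obtains g' where "smooth_on I g'" "\<And>t. t \<in> I \<Longrightarrow> (g has_vector_derivative g' t) (at t within I)"
proof -
  obtain D where D: "\<And>t. t \<in> I \<Longrightarrow> D 0 t = g t"
      "\<And>k t. t \<in> I \<Longrightarrow> (D k has_vector_derivative D (Suc k) t) (at t within I)"
    using assms by (auto simp: smooth_on_def)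
  show ?thesis
  proof
    show "smooth_on I (D 1)"
      unfolding smooth_on_def using D by (intro exI[of _ "\<lambda>k. D (Suc k)"]) auto
    show "(g has_vector_derivative D 1 t) (at t within I)" if "t \<in> I" for t
      using has_vector_derivative_transform[OF that _ D(2)[OF that, of 0], of g] D(1) by simp
  qed
qed

text \<open>Meant for antiderivatives, which are known only through their first derivative.\<close>

lemma smooth_on_if_derivative:
  assumes "smooth_on I g'" "\<And>t. t \<in> I \<Longrightarrow> (g has_vector_derivative g' t) (at t within I)"
  shows "smooth_on I g"
proof (rule smooth_on_coinduct[where X = "insert g {h. smooth_on I h}"])
  fix h assume "h \<in> insert g {h. smooth_on I h}"
  then consider "h = g" | "smooth_on I h" by blast
  then show "\<exists>h'\<in>insert g {h. smooth_on I h}. \<forall>t\<in>I. (h has_vector_derivative h' t) (at t within I)"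
  proof cases
    case 1
    then show ?thesis using assms by blast
  next
    case 2
    then obtain h' where "smooth_on I h'" "\<And>t. t \<in> I \<Longrightarrow> (h has_vector_derivative h' t) (at t within I)"
      using smooth_on_derivative by blast
    then show ?thesis by (intro bexI[of _ h']) auto
  qed
qed simp

lemma smooth_on_cong:
  assumes "smooth_on I g" "\<And>t. t \<in> I \<Longrightarrow> f t = g t"
  shows "smooth_on I f"
proof -
  obtain D where "(\<forall>t\<in>I. D 0 t = g t) \<and>
      (\<forall>k. \<forall>t\<in>I. (D k has_vector_derivative D (Suc k) t) (at t within I))"
    using assms(1) unfolding smooth_on_def by blast
  then show ?thesis
    unfolding smooth_on_def using assms(2) by (intro exI[of _ D]) auto
qed

lemma smooth_on_continuous_on:
  assumes "smooth_on I g"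
  shows "continuous_on I g"
proof -
  obtain g' where "\<And>t. t \<in> I \<Longrightarrow> (g has_vector_derivative g' t) (at t within I)"
    using assms smooth_on_derivative by blast
  then show ?thesis
    by (rule continuous_on_vector_derivative)
qed

lemma smooth_on_const [simp]: "smooth_on I (\<lambda>t. c)"
  unfolding smooth_on_def
  by (intro exI[of _ "\<lambda>k t. if k = 0 then c else 0"]) auto

lemma smooth_on_add:
  assumes "smooth_on I f" "smooth_on I g"
  shows "smooth_on I (\<lambda>t. f t + g t)"
proof (rule smooth_on_coinduct[where X = "{\<lambda>t. f t + g t | f g. smooth_on I f \<and> smooth_on I g}"])
  show "(\<lambda>t. f t + g t) \<in> {\<lambda>t. f t + g t | f g. smooth_on I f \<and> smooth_on I g}"
    using assms by blast
next
  fix h assume "h \<in> {\<lambda>t. f t + g t | f g. smooth_on I f \<and> smooth_on I g}"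
  then obtain f g where h: "h = (\<lambda>t. f t + g t)" "smooth_on I f" "smooth_on I g"
    by blast
  obtain f' where f: "smooth_on I f'" "\<And>t. t \<in> I \<Longrightarrow> (f has_vector_derivative f' t) (at t within I)"
    using h(2) smooth_on_derivative by blast
  obtain g' where g: "smooth_on I g'" "\<And>t. t \<in> I \<Longrightarrow> (g has_vector_derivative g' t) (at t within I)"
    using h(3) smooth_on_derivative by blast
  show "\<exists>h'\<in>{\<lambda>t. f t + g t | f g. smooth_on I f \<and> smooth_on I g}.
          \<forall>t\<in>I. (h has_vector_derivative h' t) (at t within I)"
    using f g by (intro bexI[of _ "\<lambda>t. f' t + g' t"]) (auto simp: h(1) intro!: derivative_intros)
qed

text \<open>Finite sums of products of smooth maps are closed under differentiation, by the Leibniz rule.\<close>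

lemma smooth_on_bilinear:
  fixes f :: "real \<Rightarrow> 'a::real_normed_vector" and g :: "real \<Rightarrow> 'b::real_normed_vector"
    and P :: "'a \<Rightarrow> 'b \<Rightarrow> 'c::real_normed_vector"
  assumes "bounded_bilinear P" "smooth_on I f" "smooth_on I g"
  shows "smooth_on I (\<lambda>t. P (f t) (g t))"
proof -
  interpret bounded_bilinear P by fact
  define S where "S = (\<lambda>(xs::((real \<Rightarrow> 'a) \<times> (real \<Rightarrow> 'b)) list) t. \<Sum>(f, g)\<leftarrow>xs. P (f t) (g t))"
  define ok where "ok = (\<lambda>xs::((real \<Rightarrow> 'a) \<times> (real \<Rightarrow> 'b)) list. \<forall>(f, g)\<in>set xs. smooth_on I f \<and> smooth_on I g)"
  have deriv: "\<exists>ys. ok ys \<and> (\<forall>t\<in>I. (S xs has_vector_derivative S ys t) (at t within I))"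
    if "ok xs" for xs
    using that
  proof (induction xs)
    case Nil
    then show ?case by (intro exI[of _ "[]"]) (auto simp: S_def ok_def)
  next
    case (Cons p xs)
    obtain f g where p: "p = (f, g)" by force
    have sm: "smooth_on I f" "smooth_on I g" and "ok xs"
      using Cons.prems by (auto simp: p ok_def)
    obtain f' where f: "smooth_on I f'" "\<And>t. t \<in> I \<Longrightarrow> (f has_vector_derivative f' t) (at t within I)"
      using sm(1) smooth_on_derivative by blast
    obtain g' where g: "smooth_on I g'" "\<And>t. t \<in> I \<Longrightarrow> (g has_vector_derivative g' t) (at t within I)"
      using sm(2) smooth_on_derivative by blast
    obtain ys where ys: "ok ys" "\<And>t. t \<in> I \<Longrightarrow> (S xs has_vector_derivative S ys t) (at t within I)"
      using Cons.IH \<open>ok xs\<close> by blast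
    have eq: "S (p # xs) = (\<lambda>t. P (f t) (g t) + S xs t)"
      by (auto simp: S_def p)
    have "ok ((f, g') # (f', g) # ys)"
      using sm f g ys by (auto simp: ok_def)
    moreover have "(S (p # xs) has_vector_derivative S ((f, g') # (f', g) # ys) t) (at t within I)"
      if "t \<in> I" for t
    proof -
      have "(S (p # xs) has_vector_derivative P (f t) (g' t) + P (f' t) (g t) + S ys t) (at t within I)"
        unfolding eq using that f g ys
        by (intro has_vector_derivative_add has_vector_derivative) auto
      then show ?thesis by (simp add: S_def add.assoc)
    qed
    ultimately show ?case by blast
  qed
  show ?thesis
  proof (rule smooth_on_coinduct[where X = "{S xs | xs. ok xs}"])
    have "(\<lambda>t. P (f t) (g t)) = S [(f, g)]" "ok [(f, g)]"
      using assms by (auto simp: S_def ok_def)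
    then show "(\<lambda>t. P (f t) (g t)) \<in> {S xs | xs. ok xs}" by blast
  next
    fix h assume "h \<in> {S xs | xs. ok xs}"
    then show "\<exists>h'\<in>{S xs | xs. ok xs}. \<forall>t\<in>I. (h has_vector_derivative h' t) (at t within I)"
      using deriv by blast
  qed
qed

lemmas smooth_on_scaleR = smooth_on_bilinear[OF bounded_bilinear_scaleR]

lemma smooth_on_mult:
  fixes f g :: "real \<Rightarrow> real"
  shows "smooth_on I f \<Longrightarrow> smooth_on I g \<Longrightarrow> smooth_on I (\<lambda>t. f t * g t)"
  by (rule smooth_on_bilinear[OF bounded_bilinear_mult])

lemma smooth_on_minus: "smooth_on I f \<Longrightarrow> smooth_on I (\<lambda>t. - f t)"
  using smooth_on_scaleR[OF smooth_on_const[of I "-1"], of f] by simp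

lemma smooth_on_diff: "smooth_on I f \<Longrightarrow> smooth_on I g \<Longrightarrow> smooth_on I (\<lambda>t. f t - g t)"
  using smooth_on_add[OF _ smooth_on_minus, of I f g] by simp

lemma smooth_on_power:
  fixes f :: "real \<Rightarrow> real"
  shows "smooth_on I f \<Longrightarrow> smooth_on I (\<lambda>t. f t ^ k)"
  by (induction k) (auto intro: smooth_on_mult)

lemma smooth_on_divide_const:
  fixes f :: "real \<Rightarrow> real"
  shows "smooth_on I f \<Longrightarrow> smooth_on I (\<lambda>t. f t / c)"
  using smooth_on_mult[of I f "\<lambda>t. 1 / c"] by simp

text \<open>For fixed \<open>f\<close> the products \<open>h * exp f\<close> are stable:
  differentiation replaces \<open>h\<close> by \<open>h' + h * f'\<close>.\<close>

lemma smooth_on_exp: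
  fixes f :: "real \<Rightarrow> real"
  assumes "smooth_on I f"
  shows "smooth_on I (\<lambda>t. exp (f t))"
proof (rule smooth_on_coinduct[where X = "{\<lambda>t. h t * exp (f t) | h. smooth_on I h}"])
  show "(\<lambda>t. exp (f t)) \<in> {\<lambda>t. h t * exp (f t) | h. smooth_on I h}"
    by (rule CollectI, rule exI[of _ "\<lambda>t. 1"]) simp
next
  obtain f' where f: "smooth_on I f'" "\<And>t. t \<in> I \<Longrightarrow> (f has_vector_derivative f' t) (at t within I)"
    using assms smooth_on_derivative by blast
  fix g assume "g \<in> {\<lambda>t. h t * exp (f t) | h. smooth_on I h}"
  then obtain h where g: "g = (\<lambda>t. h t * exp (f t))" "smooth_on I h"
    by blast
  obtain h' where h: "smooth_on I h'" "\<And>t. t \<in> I \<Longrightarrow> (h has_vector_derivative h' t) (at t within I)"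
    using g(2) smooth_on_derivative by blast
  have "(g has_vector_derivative (h' t + h t * f' t) * exp (f t)) (at t within I)" if "t \<in> I" for t
    unfolding g(1) using f(2)[OF that] h(2)[OF that]
    unfolding has_real_derivative_iff_has_vector_derivative[symmetric]
    by (auto intro!: derivative_eq_intros simp: algebra_simps)
  then show "\<exists>g'\<in>{\<lambda>t. h t * exp (f t) | h. smooth_on I h}.
      \<forall>t\<in>I. (g has_vector_derivative g' t) (at t within I)"
    using smooth_on_add[OF h(1) smooth_on_mult[OF g(2) f(1)]]
    by (intro bexI[of _ "\<lambda>t. (h' t + h t * f' t) * exp (f t)"] ballI)
      (assumption | rule CollectI exI[of _ "\<lambda>t. h' t + h t * f' t"] conjI refl)+
qed

text \<open>For fixed \<open>g\<close> the quotients \<open>h / g ^ k\<close> are stable: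
  differentiation replaces \<open>h\<close> by \<open>h' * g - k * h * g'\<close> and raises
  \<open>k\<close> by one.\<close>

lemma smooth_on_divide:
  fixes f g :: "real \<Rightarrow> real"
  assumes "smooth_on I f" "smooth_on I g" and nz: "\<And>t. t \<in> I \<Longrightarrow> g t \<noteq> 0"
  shows "smooth_on I (\<lambda>t. f t / g t)"
proof (rule smooth_on_coinduct[where X = "{\<lambda>t. h t / g t ^ k | h k. smooth_on I h}"])
  show "(\<lambda>t. f t / g t) \<in> {\<lambda>t. h t / g t ^ k | h k. smooth_on I h}"
    using assms(1) by (intro CollectI exI[of _ f] exI[of _ 1]) simp
next
  obtain g' where g: "smooth_on I g'" "\<And>t. t \<in> I \<Longrightarrow> (g has_vector_derivative g' t) (at t within I)"
    using assms(2) smooth_on_derivative by blast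
  fix q assume "q \<in> {\<lambda>t. h t / g t ^ k | h k. smooth_on I h}"
  then obtain h k where q: "q = (\<lambda>t. h t / g t ^ k)" "smooth_on I h"
    by blast
  obtain h' where h: "smooth_on I h'" "\<And>t. t \<in> I \<Longrightarrow> (h has_vector_derivative h' t) (at t within I)"
    using q(2) smooth_on_derivative by blast
  define h1 where "h1 = (\<lambda>t. h' t * g t - real k * (h t * g' t))"
  have "(q has_vector_derivative h1 t / g t ^ Suc k) (at t within I)" if "t \<in> I" for t
  proof -
    note [derivative_intros] = g(2)[OF that, folded has_real_derivative_iff_has_vector_derivative]
      h(2)[OF that, folded has_real_derivative_iff_has_vector_derivative]
    have "(q has_real_derivative (h' t * g t ^ k - h t * (real k * (g' t * g t ^ (k - 1))))
        / (g t ^ k * g t ^ k)) (at t within I)"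
      unfolding q(1) using nz[OF that] by (auto intro!: derivative_eq_intros)
    moreover have "(h' t * g t ^ k - h t * (real k * (g' t * g t ^ (k - 1)))) / (g t ^ k * g t ^ k)
        = h1 t / g t ^ Suc k"
    \<comment> \<open>For \<open>k = 0\<close> the truncated \<open>k - 1\<close> is harmless, since
      its term carries the factor \<open>real k\<close>. Otherwise a common factor
      \<open>g t ^ j\<close> cancels.\<close>
    proof (cases k)
      case 0
      then show ?thesis using nz[OF that] by (simp add: h1_def)
    next
      case (Suc j)
      have "(a * (x * p) - b * (c * (d * p))) / (x * p * (x * p)) = (a * x - c * (b * d)) / (x * (x * p))"
        if "x \<noteq> 0" "p \<noteq> 0" for a b c d x p :: real
        using that by (simp add: divide_simps) algebra
      from this[of "g t" "g t ^ j"] show ?thesis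
        using nz[OF that] by (simp add: Suc h1_def)
    qed
    ultimately show ?thesis
      by (simp add: has_real_derivative_iff_has_vector_derivative)
  qed
  moreover have "smooth_on I h1"
    unfolding h1_def using assms(2) g(1) q(2) h(1)
    by (intro smooth_on_diff smooth_on_mult smooth_on_const)
  ultimately show "\<exists>q'\<in>{\<lambda>t. h t / g t ^ k | h k. smooth_on I h}.
      \<forall>t\<in>I. (q has_vector_derivative q' t) (at t within I)"
    by (intro bexI[of _ "\<lambda>t. h1 t / g t ^ Suc k"] ballI)
      (assumption | rule CollectI exI[of _ h1] exI[of _ "Suc k"] conjI refl)+
qed

lemmas smooth_on_intros = smooth_on_add smooth_on_mult smooth_on_minus smooth_on_diff
  smooth_on_power smooth_on_divide_const smooth_on_exp smooth_on_scaleR smooth_on_const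

section \<open>Frames in Lorentz-Minkowski space\<close>

lemma bounded_bilinear_lorentz_wedge: "bounded_bilinear lorentz_wedge"
  unfolding bilinear_conv_bounded_bilinear[symmetric] bilinear_def
  by (intro conjI allI linearI; simp add: lorentz_wedge_def vec_eq_iff forall_3 algebra_simps)

lemma bounded_bilinear_lorentz_inner: "bounded_bilinear lorentz_inner"
  unfolding bilinear_conv_bounded_bilinear[symmetric] bilinear_def
  by (intro conjI allI linearI; simp add: lorentz_inner_def algebra_simps)

interpretation wedge: bounded_bilinear lorentz_wedge
  by (rule bounded_bilinear_lorentz_wedge)

interpretation lorentz: bounded_bilinear lorentz_inner
  by (rule bounded_bilinear_lorentz_inner)

lemma lorentz_inner_commute: "lorentz_inner x y = lorentz_inner y x"
  by (simp add: lorentz_inner_def)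

lemma lorentz_wedge_skew: "lorentz_wedge y x = - lorentz_wedge x y"
  by (simp add: lorentz_wedge_def vec_eq_iff forall_3)

lemma lorentz_wedge_self: "lorentz_wedge x x = 0"
  by (simp add: lorentz_wedge_def vec_eq_iff forall_3)

lemma lorentz_inner_wedge_left: "lorentz_inner x (lorentz_wedge x y) = 0"
  by (simp add: lorentz_wedge_def lorentz_inner_def algebra_simps)

lemma lorentz_inner_wedge_right: "lorentz_inner y (lorentz_wedge x y) = 0"
  by (simp add: lorentz_wedge_def lorentz_inner_def algebra_simps)

lemma lorentz_inner_wedge_wedge:
  "lorentz_inner (lorentz_wedge x y) (lorentz_wedge x y) =
     (lorentz_inner x y)\<^sup>2 - lorentz_inner x x * lorentz_inner y y"
  by (simp add: lorentz_wedge_def lorentz_inner_def power2_eq_square algebra_simps)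

lemma lorentz_wedge_wedge_left:
  "lorentz_wedge x (lorentz_wedge x y) = lorentz_inner x x *\<^sub>R y - lorentz_inner x y *\<^sub>R x"
  by (simp add: lorentz_wedge_def lorentz_inner_def vec_eq_iff forall_3 algebra_simps)

lemma lorentz_wedge_wedge_right:
  "lorentz_wedge (lorentz_wedge x y) y = lorentz_inner y y *\<^sub>R x - lorentz_inner x y *\<^sub>R y"
  by (simp add: lorentz_wedge_def lorentz_inner_def vec_eq_iff forall_3 algebra_simps)

text \<open>Reverse Cauchy-Schwarz: for unit timelike vectors the product of the first coordinates
  exceeds the spatial product in absolute value, so it has the sign opposite to that of the inner
  product. This avoids computing the first coordinate of a vector given in the moving frame.\<close>

lemma timelike_same_sheet:
  assumes "lorentz_inner x x = -1" "y \<in> hyperbolic_plane" "lorentz_inner x y < 0"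
  shows "x \<in> hyperbolic_plane"
proof -
  have y: "(y$1)\<^sup>2 = 1 + (y$2)\<^sup>2 + (y$3)\<^sup>2" "y$1 > 0"
    using assms(2) by (auto simp: hyperbolic_plane_def lorentz_inner_def power2_eq_square)
  have x: "(x$1)\<^sup>2 = 1 + (x$2)\<^sup>2 + (x$3)\<^sup>2"
    using assms(1) by (auto simp: lorentz_inner_def power2_eq_square)
  have xy: "x$2 * y$2 + x$3 * y$3 < x$1 * y$1"
    using assms(3) by (simp add: lorentz_inner_def)
  have "x$1 > 0"
  proof (rule ccontr)
    assume "\<not> x$1 > 0"
    then have "x$1 * y$1 \<le> 0"
      using y(2) by (simp add: mult_nonpos_nonneg)
    then have "(x$1 * y$1)\<^sup>2 \<le> (x$2 * y$2 + x$3 * y$3)\<^sup>2"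
      using xy abs_le_square_iff by fastforce
    \<comment> \<open>Lagrange's identity in the plane of the two spatial coordinates.\<close>
    also have "\<dots> = ((x$2)\<^sup>2 + (x$3)\<^sup>2) * ((y$2)\<^sup>2 + (y$3)\<^sup>2) - (x$2 * y$3 - x$3 * y$2)\<^sup>2"
      by (simp add: power2_eq_square algebra_simps)
    also have "\<dots> \<le> ((x$2)\<^sup>2 + (x$3)\<^sup>2) * ((y$2)\<^sup>2 + (y$3)\<^sup>2)"
      by simp
    also have "\<dots> < (1 + (x$2)\<^sup>2 + (x$3)\<^sup>2) * (1 + (y$2)\<^sup>2 + (y$3)\<^sup>2)"
      by (simp add: algebra_simps add_strict_increasing add_nonneg_pos)
    also have "\<dots> = (x$1 * y$1)\<^sup>2"
      by (simp add: x y power_mult_distrib)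
    finally show False by simp
  qed
  then show ?thesis
    using assms(1) by (simp add: hyperbolic_plane_def)
qed

text \<open>The coefficients are numbers, so that pointwise identities become algebra of triples;
  coefficient functions enter by abstraction over \<open>t\<close> when derivatives are
  taken.\<close>

definition frame_vector ::
  "(real \<Rightarrow> real^3) \<Rightarrow> (real \<Rightarrow> real^3) \<Rightarrow> real \<Rightarrow> real \<Rightarrow> real \<Rightarrow> real \<Rightarrow> real^3" where
  "frame_vector \<gamma> \<nu> x y z t = x *\<^sub>R \<gamma> t + y *\<^sub>R \<nu> t + z *\<^sub>R third_frame \<gamma> \<nu> t"

lemma lorentz_frame:
  assumes "(\<gamma> t, \<nu> t) \<in> Delta1"
  shows "lorentz_inner (\<gamma> t) (\<gamma> t) = -1" "lorentz_inner (\<nu> t) (\<nu> t) = 1"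
    "lorentz_inner (\<gamma> t) (\<nu> t) = 0" "lorentz_inner (\<nu> t) (\<gamma> t) = 0"
    "lorentz_inner (\<gamma> t) (third_frame \<gamma> \<nu> t) = 0" "lorentz_inner (third_frame \<gamma> \<nu> t) (\<gamma> t) = 0"
    "lorentz_inner (\<nu> t) (third_frame \<gamma> \<nu> t) = 0" "lorentz_inner (third_frame \<gamma> \<nu> t) (\<nu> t) = 0"
    "lorentz_inner (third_frame \<gamma> \<nu> t) (third_frame \<gamma> \<nu> t) = 1"
    "lorentz_wedge (\<gamma> t) (\<nu> t) = third_frame \<gamma> \<nu> t"
    "lorentz_wedge (\<nu> t) (\<gamma> t) = - third_frame \<gamma> \<nu> t"
    "lorentz_wedge (\<gamma> t) (third_frame \<gamma> \<nu> t) = - \<nu> t"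
    "lorentz_wedge (third_frame \<gamma> \<nu> t) (\<gamma> t) = \<nu> t"
    "lorentz_wedge (third_frame \<gamma> \<nu> t) (\<nu> t) = \<gamma> t"
    "lorentz_wedge (\<nu> t) (third_frame \<gamma> \<nu> t) = - \<gamma> t"
  using assms
  by (simp_all add: Delta1_def hyperbolic_plane_def de_sitter_space_def third_frame_def
      lorentz_inner_wedge_wedge lorentz_inner_wedge_left lorentz_inner_wedge_right
      lorentz_wedge_wedge_left lorentz_wedge_wedge_right
      lorentz_inner_commute[of "\<nu> t" "\<gamma> t"] lorentz_inner_commute[of "lorentz_wedge (\<gamma> t) (\<nu> t)" "\<gamma> t"]
      lorentz_inner_commute[of "lorentz_wedge (\<gamma> t) (\<nu> t)" "\<nu> t"]
      lorentz_wedge_skew[of "lorentz_wedge (\<gamma> t) (\<nu> t)" "\<gamma> t"]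
      lorentz_wedge_skew[of "\<nu> t" "lorentz_wedge (\<gamma> t) (\<nu> t)"] lorentz_wedge_skew[of "\<nu> t" "\<gamma> t"])

lemma frame_vector_inner:
  assumes "(\<gamma> t, \<nu> t) \<in> Delta1"
  shows "lorentz_inner (frame_vector \<gamma> \<nu> x y z t) (frame_vector \<gamma> \<nu> x' y' z' t)
    = - x * x' + y * y' + z * z'"
  by (simp add: frame_vector_def lorentz.add_left lorentz.add_right lorentz.scaleR_left
      lorentz.scaleR_right lorentz_frame[of \<gamma> t \<nu>, OF assms])

lemma frame_vector_wedge:
  assumes "(\<gamma> t, \<nu> t) \<in> Delta1"
  shows "lorentz_wedge (frame_vector \<gamma> \<nu> x y z t) (frame_vector \<gamma> \<nu> x' y' z' t)
    = frame_vector \<gamma> \<nu> (z * y' - y * z') (z * x' - x * z') (x * y' - y * x') t"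
  by (simp add: frame_vector_def wedge.add_left wedge.add_right wedge.scaleR_left
      wedge.scaleR_right lorentz_frame[of \<gamma> t \<nu>, OF assms] lorentz_wedge_self algebra_simps)

lemma frame_vector_scaleR:
  "a *\<^sub>R frame_vector \<gamma> \<nu> x y z t = frame_vector \<gamma> \<nu> (a * x) (a * y) (a * z) t"
  by (simp add: frame_vector_def algebra_simps)

lemma frame_vector_add:
  "frame_vector \<gamma> \<nu> x y z t + frame_vector \<gamma> \<nu> x' y' z' t
    = frame_vector \<gamma> \<nu> (x + x') (y + y') (z + z') t"
  by (simp add: frame_vector_def algebra_simps)

lemma horocyclic_involute_frame_vector:
  "horocyclic_involute \<sigma> \<gamma> \<nu> s t = frame_vector \<gamma> \<nu> (1 + (s t)\<^sup>2 / 2) (\<sigma> * (s t)\<^sup>2 / 2) (s t) t"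
  by (simp add: horocyclic_involute_def frame_vector_def algebra_simps)

lemma involute_normal_frame_vector:
  "involute_normal \<sigma> \<gamma> \<nu> s t = frame_vector \<gamma> \<nu> (- s t) (- \<sigma> * s t) (-1) t"
  by (simp add: involute_normal_def frame_vector_def algebra_simps)

lemma horocyclic_evolute_frame_vector:
  "horocyclic_evolute \<sigma> \<gamma> \<nu> f t = frame_vector \<gamma> \<nu> (1 + (f t)\<^sup>2 / 2) (f t) (\<sigma> * (f t)\<^sup>2 / 2) t"
  by (simp add: horocyclic_evolute_def frame_vector_def algebra_simps)

lemma evolute_normal_frame_vector:
  "evolute_normal \<sigma> \<gamma> \<nu> f t =
     frame_vector \<gamma> \<nu> (- \<sigma> * (f t)\<^sup>2 / 2) (- \<sigma> * f t) (1 - (f t)\<^sup>2 / 2) t"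
  by (simp add: evolute_normal_def frame_vector_def algebra_simps)

section \<open>Curvature\<close>

text \<open>Derivatives within \<open>I\<close> are unique only for a nontrivial filter. Nonempty
  interior excludes singletons, and a connected set that is not a singleton has no isolated
  point.\<close>

lemma at_within_interval_neq_bot:
  fixes I :: "real set"
  assumes "is_interval I" "interior I \<noteq> {}" "t \<in> I"
  shows "at t within I \<noteq> bot"
proof -
  have "I \<noteq> {x}" for x
    using assms(2) interior_singleton by metis
  then have "t islimpt I"
    using assms connected_imp_perfect is_interval_connected by blast
  then show ?thesis
    using trivial_limit_within by blast
qed

lemma third_frame_smooth:
  "smooth_on I \<gamma> \<Longrightarrow> smooth_on I \<nu> \<Longrightarrow> smooth_on I (third_frame \<gamma> \<nu>)"
  using smooth_on_bilinear[OF bounded_bilinear_lorentz_wedge, of I \<gamma> \<nu>]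
  by (simp add: third_frame_def[abs_def])

lemma legendre_curvature_Delta1:
  "legendre_curvature I \<gamma> \<nu> m n \<Longrightarrow> t \<in> I \<Longrightarrow> (\<gamma> t, \<nu> t) \<in> Delta1"
  by (simp add: legendre_curvature_def spacelike_legendre_curve_def)

text \<open>The Leibniz rule for the wedge product, combined with
  \<open>\<gamma> \<and> \<mu> = - \<nu>\<close> and \<open>\<mu> \<and> \<nu> = \<gamma>\<close>
  (wedge products).\<close>

lemma third_frame_derivative:
  assumes "legendre_curvature I \<gamma> \<nu> m n" "t \<in> I"
  shows "(third_frame \<gamma> \<nu> has_vector_derivative m t *\<^sub>R \<gamma> t - n t *\<^sub>R \<nu> t) (at t within I)"
proof -
  have "((\<lambda>t. lorentz_wedge (\<gamma> t) (\<nu> t)) has_vector_derivative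
      lorentz_wedge (\<gamma> t) (n t *\<^sub>R third_frame \<gamma> \<nu> t)
        + lorentz_wedge (m t *\<^sub>R third_frame \<gamma> \<nu> t) (\<nu> t)) (at t within I)"
    using assms by (intro wedge.has_vector_derivative) (auto simp: legendre_curvature_def)
  moreover have "(\<lambda>t. lorentz_wedge (\<gamma> t) (\<nu> t)) = third_frame \<gamma> \<nu>"
    by (simp add: third_frame_def fun_eq_iff)
  ultimately show ?thesis
    using lorentz_frame[of \<gamma> t \<nu>, OF legendre_curvature_Delta1[OF assms]]
    by (simp add: wedge.scaleR_left wedge.scaleR_right)
qed

lemma frame_vector_derivative:
  assumes "legendre_curvature I \<gamma> \<nu> m n" "t \<in> I"
    and "(x has_real_derivative x') (at t within I)" "(y has_real_derivative y') (at t within I)"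
      "(z has_real_derivative z') (at t within I)"
  shows "((\<lambda>t. frame_vector \<gamma> \<nu> (x t) (y t) (z t) t) has_vector_derivative
    frame_vector \<gamma> \<nu> (x' + m t * z t) (y' - n t * z t) (z' + m t * x t + n t * y t) t) (at t within I)"
proof -
  have "((\<lambda>t. x t *\<^sub>R \<gamma> t + y t *\<^sub>R \<nu> t + z t *\<^sub>R third_frame \<gamma> \<nu> t) has_vector_derivative
      (x t *\<^sub>R m t *\<^sub>R third_frame \<gamma> \<nu> t + x' *\<^sub>R \<gamma> t)
      + (y t *\<^sub>R n t *\<^sub>R third_frame \<gamma> \<nu> t + y' *\<^sub>R \<nu> t)
      + (z t *\<^sub>R (m t *\<^sub>R \<gamma> t - n t *\<^sub>R \<nu> t) + z' *\<^sub>R third_frame \<gamma> \<nu> t)) (at t within I)"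
    using assms third_frame_derivative[OF assms(1,2)]
    by (intro has_vector_derivative_add has_vector_derivative_scaleR)
       (auto simp: legendre_curvature_def)
  then show ?thesis
    by (simp add: frame_vector_def[abs_def] algebra_simps)
qed

text \<open>The Legendre condition is automatic once the derivatives are multiples of the third frame
  vector; the coordinate equations in the last six assumptions say exactly this.\<close>

lemma legendre_curvature_frame_vector:
  fixes x y z x' y' z' :: "real \<Rightarrow> real"
  assumes curv: "legendre_curvature I \<gamma> \<nu> m n"
    and nontriv: "\<And>t. t \<in> I \<Longrightarrow> at t within I \<noteq> bot"
    and smooth: "smooth_on I x" "smooth_on I y" "smooth_on I z"
      "smooth_on I x'" "smooth_on I y'" "smooth_on I z'" "smooth_on I p" "smooth_on I q"
    and norm: "\<And>t. t \<in> I \<Longrightarrow> - (x t)\<^sup>2 + (y t)\<^sup>2 + (z t)\<^sup>2 = -1" "\<And>t. t \<in> I \<Longrightarrow> x t > 0"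
      "\<And>t. t \<in> I \<Longrightarrow> - (x' t)\<^sup>2 + (y' t)\<^sup>2 + (z' t)\<^sup>2 = 1"
      "\<And>t. t \<in> I \<Longrightarrow> - x t * x' t + y t * y' t + z t * z' t = 0"
    and deriv: "\<And>t. t \<in> I \<Longrightarrow> (x has_real_derivative dx t) (at t within I)"
      "\<And>t. t \<in> I \<Longrightarrow> (y has_real_derivative dy t) (at t within I)"
      "\<And>t. t \<in> I \<Longrightarrow> (z has_real_derivative dz t) (at t within I)"
      "\<And>t. t \<in> I \<Longrightarrow> (x' has_real_derivative dx' t) (at t within I)"
      "\<And>t. t \<in> I \<Longrightarrow> (y' has_real_derivative dy' t) (at t within I)"
      "\<And>t. t \<in> I \<Longrightarrow> (z' has_real_derivative dz' t) (at t within I)"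
    and eqs: "\<And>t. t \<in> I \<Longrightarrow> dx t + m t * z t = p t * (z t * y' t - y t * z' t)"
      "\<And>t. t \<in> I \<Longrightarrow> dy t - n t * z t = p t * (z t * x' t - x t * z' t)"
      "\<And>t. t \<in> I \<Longrightarrow> dz t + m t * x t + n t * y t = p t * (x t * y' t - y t * x' t)"
      "\<And>t. t \<in> I \<Longrightarrow> dx' t + m t * z' t = q t * (z t * y' t - y t * z' t)"
      "\<And>t. t \<in> I \<Longrightarrow> dy' t - n t * z' t = q t * (z t * x' t - x t * z' t)"
      "\<And>t. t \<in> I \<Longrightarrow> dz' t + m t * x' t + n t * y' t = q t * (x t * y' t - y t * x' t)"
  shows "legendre_curvature I (\<lambda>t. frame_vector \<gamma> \<nu> (x t) (y t) (z t) t)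
    (\<lambda>t. frame_vector \<gamma> \<nu> (x' t) (y' t) (z' t) t) p q"
    (is "legendre_curvature I ?J ?K p q")
proof -
  have sm: "smooth_on I \<gamma>" "smooth_on I \<nu>"
    using curv by (auto simp: legendre_curvature_def spacelike_legendre_curve_def)
  have smJK: "smooth_on I ?J" "smooth_on I ?K"
    using sm smooth third_frame_smooth[OF sm]
    by (auto simp: frame_vector_def[abs_def] intro!: smooth_on_intros)
  have D: "(\<gamma> t, \<nu> t) \<in> Delta1" if "t \<in> I" for t
    using curv that by (rule legendre_curvature_Delta1)
  have "(?J t, ?K t) \<in> Delta1" if "t \<in> I" for t
  proof -
    \<comment> \<open>Pairing with \<open>\<gamma> t\<close> reads off the timelike coordinate, so
      \<open>x t > 0\<close> puts \<open>?J t\<close> on the sheet of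
      \<open>\<gamma> t\<close>.\<close>
    have "lorentz_inner (?J t) (\<gamma> t) = - x t"
      using frame_vector_inner[of \<gamma> t \<nu>, OF D[OF that], of "x t" "y t" "z t" 1 0 0]
      by (simp add: frame_vector_def)
    moreover have "\<gamma> t \<in> hyperbolic_plane"
      using D[OF that] by (simp add: Delta1_def)
    moreover have "lorentz_inner (?J t) (?J t) = -1"
      using norm(1)[OF that] by (simp add: frame_vector_inner[of \<gamma> t \<nu>, OF D[OF that]] power2_eq_square)
    ultimately have "?J t \<in> hyperbolic_plane"
      using timelike_same_sheet norm(2)[OF that] by fastforce
    then show ?thesis
      using norm(3,4)[OF that]
      by (simp add: Delta1_def de_sitter_space_def frame_vector_inner[of \<gamma> t \<nu>, OF D[OF that]] power2_eq_square)
  qed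
  moreover have third: "third_frame ?J ?K t = frame_vector \<gamma> \<nu> (z t * y' t - y t * z' t)
      (z t * x' t - x t * z' t) (x t * y' t - y t * x' t) t" if "t \<in> I" for t
    using frame_vector_wedge[of \<gamma> t \<nu>, OF D[OF that]] by (simp add: third_frame_def[of ?J])
  have dJ: "(?J has_vector_derivative p t *\<^sub>R third_frame ?J ?K t) (at t within I)" if "t \<in> I" for t
    using frame_vector_derivative[OF curv that deriv(1-3)[OF that]]
    by (simp add: third[OF that] frame_vector_scaleR eqs[OF that])
  moreover have dK: "(?K has_vector_derivative q t *\<^sub>R third_frame ?J ?K t) (at t within I)" if "t \<in> I" for t
    using frame_vector_derivative[OF curv that deriv(4-6)[OF that]]
    by (simp add: third[OF that] frame_vector_scaleR eqs[OF that])
  moreover have "lorentz_inner (vector_derivative ?J (at t within I)) (?K t) = 0" if "t \<in> I" for t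
    unfolding vector_derivative_within[OF nontriv[OF that] dJ[OF that]]
    by (simp add: third_frame_def lorentz.scaleR_left
        lorentz_inner_commute[of "lorentz_wedge _ _"] lorentz_inner_wedge_right)
  ultimately show ?thesis
    using smJK smooth by (simp add: legendre_curvature_def spacelike_legendre_curve_def)
qed

lemma third_frame_minus: "third_frame \<gamma> (\<lambda>t. - \<nu> t) t = - third_frame \<gamma> \<nu> t"
  by (simp add: third_frame_def wedge.minus_right)

text \<open>The third frame vector changes sign with \<open>\<nu>\<close>. Hence the coefficient of
  the derivative of \<open>\<gamma>\<close> changes sign, while in the derivative of
  \<open>- \<nu>\<close> the two signs cancel.\<close>

lemma legendre_curvature_minus:
  assumes "legendre_curvature I \<gamma> \<nu> m n"
  shows "legendre_curvature I \<gamma> (\<lambda>t. - \<nu> t) (\<lambda>t. - m t) n"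
proof -
  have "((\<lambda>t. - \<nu> t) has_vector_derivative - (n t *\<^sub>R third_frame \<gamma> \<nu> t)) (at t within I)"
    if "t \<in> I" for t
    using assms that by (intro has_vector_derivative_minus) (auto simp: legendre_curvature_def)
  then show ?thesis
    using assms
    by (auto simp: legendre_curvature_def spacelike_legendre_curve_def third_frame_minus
        Delta1_def de_sitter_space_def lorentz.minus_left lorentz.minus_right
        intro: smooth_on_minus)
qed

text \<open>The third frame vector has Lorentz square 1 and so is nonzero; the derivatives determine
  their coefficients along it. This removes the existential quantifier over curvatures from the
  predicates that follow.\<close>

lemma legendre_curvature_unique:
  assumes "legendre_curvature I \<gamma> \<nu> m n" "legendre_curvature I \<gamma> \<nu> m' n'"
    and "t \<in> I" "at t within I \<noteq> bot"
  shows "m' t = m t" "n' t = n t"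
proof -
  let ?\<mu> = "third_frame \<gamma> \<nu> t"
  have "lorentz_inner ?\<mu> ?\<mu> = 1"
    using lorentz_frame[of \<gamma> t \<nu>, OF legendre_curvature_Delta1[OF assms(1,3)]] by simp
  then have "?\<mu> \<noteq> 0"
    by (auto simp: lorentz.zero_left)
  moreover have "m' t *\<^sub>R ?\<mu> = m t *\<^sub>R ?\<mu>" "n' t *\<^sub>R ?\<mu> = n t *\<^sub>R ?\<mu>"
    by (rule vector_derivative_unique_within[OF assms(4)];
        use assms in \<open>auto simp: legendre_curvature_def\<close>)+
  ultimately show "m' t = m t" "n' t = n t" by auto
qed

lemma evolute_function_iff:
  assumes "legendre_curvature I \<gamma> \<nu> m n" "\<And>t. t \<in> I \<Longrightarrow> at t within I \<noteq> bot"
  shows "evolute_function I \<gamma> \<nu> f \<longleftrightarrow> smooth_on I f \<and> (\<forall>t\<in>I. m t + f t * n t = 0)"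
proof
  assume "evolute_function I \<gamma> \<nu> f"
  then obtain m' n' where mn: "legendre_curvature I \<gamma> \<nu> m' n'" "smooth_on I f"
      "\<forall>t\<in>I. m' t + f t * n' t = 0"
    by (auto simp: evolute_function_def)
  then show "smooth_on I f \<and> (\<forall>t\<in>I. m t + f t * n t = 0)"
    using legendre_curvature_unique[OF assms(1) mn(1)] assms(2) by simp
qed (use assms in \<open>auto simp: evolute_function_def\<close>)

lemma involute_function_iff:
  assumes "legendre_curvature I \<gamma> \<nu> m n" "\<And>t. t \<in> I \<Longrightarrow> at t within I \<noteq> bot"
  shows "involute_function \<sigma> I \<gamma> \<nu> s \<longleftrightarrow> riccati_solution \<sigma> I m n s"
proof
  assume "involute_function \<sigma> I \<gamma> \<nu> s"
  then obtain m' n' where mn: "legendre_curvature I \<gamma> \<nu> m' n'" "riccati_solution \<sigma> I m' n' s"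
    by (auto simp: involute_function_def)
  then show "riccati_solution \<sigma> I m n s"
    using legendre_curvature_unique[OF assms(1) mn(1)] assms(2) by (simp add: riccati_solution_def)
qed (use assms in \<open>auto simp: involute_function_def\<close>)

section \<open>Symmetry under reversal of the normal\<close>

lemma evolute_function_minus:
  assumes "evolute_function I \<gamma> \<nu> f"
  shows "evolute_function I \<gamma> (\<lambda>t. - \<nu> t) (\<lambda>t. - f t)"
proof -
  obtain m n where "legendre_curvature I \<gamma> \<nu> m n" "smooth_on I f" "\<forall>t\<in>I. m t + f t * n t = 0"
    using assms by (auto simp: evolute_function_def)
  then show ?thesis
    unfolding evolute_function_def
    by (intro exI[of _ "\<lambda>t. - m t"] exI[of _ n])
       (auto intro: legendre_curvature_minus smooth_on_minus simp: add_eq_0_iff)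
qed

text \<open>Changing the signs of \<open>m\<close>, \<open>\<sigma>\<close> and \<open>s\<close>
  together changes the sign of both sides of the equation.\<close>

lemma riccati_solution_minus:
  assumes "riccati_solution \<sigma> I m n s"
  shows "riccati_solution (- \<sigma>) I (\<lambda>t. - m t) n (\<lambda>t. - s t)"
  using assms unfolding riccati_solution_def
  by (auto intro!: smooth_on_minus DERIV_cong[OF DERIV_minus] simp: field_simps)

lemma involute_function_minus:
  assumes "involute_function \<sigma> I \<gamma> \<nu> s"
  shows "involute_function (- \<sigma>) I \<gamma> (\<lambda>t. - \<nu> t) (\<lambda>t. - s t)"
proof -
  obtain m n where "legendre_curvature I \<gamma> \<nu> m n" "riccati_solution \<sigma> I m n s"
    using assms by (auto simp: involute_function_def)
  then show ?thesis
    unfolding involute_function_def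
    by (intro exI[of _ "\<lambda>t. - m t"] exI[of _ n] conjI legendre_curvature_minus riccati_solution_minus)
qed

lemma horocyclic_evolute_minus:
  "horocyclic_evolute (- \<sigma>) \<gamma> (\<lambda>t. - \<nu> t) f t = horocyclic_evolute \<sigma> \<gamma> \<nu> (\<lambda>t. - f t) t"
  by (simp add: horocyclic_evolute_def third_frame_minus)

text \<open>All signs cancel in pairs: \<open>- s\<close> against the reversed third frame vector,
  \<open>- \<sigma>\<close> against \<open>- \<nu>\<close>. This is why a barred involute is an
  unbarred one for the opposite sign.\<close>

lemma horocyclic_involute_minus:
  "horocyclic_involute (- \<sigma>) \<gamma> (\<lambda>t. - \<nu> t) (\<lambda>t. - s t) t = horocyclic_involute \<sigma> \<gamma> \<nu> s t"
  by (simp add: horocyclic_involute_def third_frame_minus)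

text \<open>For any differentiable \<open>s\<close> the inner product of the derivative of the
  involute with \<open>involute_normal\<close> is
  \<open>(m + \<sigma> * n) / 2 * s^2 - m - s'\<close>; the Riccati equation is exactly the Legendre
  condition.\<close>

lemma legendre_curvature_involute:
  assumes curv: "legendre_curvature I \<gamma> \<nu> m n" and "\<sigma> \<in> {1, -1}"
    and nontriv: "\<And>t. t \<in> I \<Longrightarrow> at t within I \<noteq> bot"
    and s: "riccati_solution \<sigma> I m n s"
  shows "legendre_curvature I (horocyclic_involute \<sigma> \<gamma> \<nu> s) (involute_normal \<sigma> \<gamma> \<nu> s)
    (\<lambda>t. - s t * (n t + \<sigma> * m t)) (\<lambda>t. n t + \<sigma> * m t)"
proof -
  have sm: "smooth_on I m" "smooth_on I n" "smooth_on I s"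
    using curv s by (auto simp: legendre_curvature_def riccati_solution_def)
  define s' where "s' = (\<lambda>t. (m t + \<sigma> * n t) / 2 * (s t)\<^sup>2 - m t)"
  have ds: "(s has_real_derivative s' t) (at t within I)" if "t \<in> I" for t
    using s that by (auto simp: riccati_solution_def s'_def)
  have d: "((\<lambda>t. 1 + (s t)\<^sup>2 / 2) has_real_derivative s t * s' t) (at t within I)"
    "((\<lambda>t. \<sigma> * (s t)\<^sup>2 / 2) has_real_derivative \<sigma> * s t * s' t) (at t within I)"
    "((\<lambda>t. - s t) has_real_derivative - s' t) (at t within I)"
    "((\<lambda>t. - \<sigma> * s t) has_real_derivative - \<sigma> * s' t) (at t within I)"
    "((\<lambda>t. -1) has_real_derivative 0) (at t within I)" if "t \<in> I" for t
    using ds[OF that] by (auto intro!: derivative_eq_intros)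
  have \<sigma>: "\<sigma> = 1 \<or> \<sigma> = -1" using assms(2) by auto
  have "legendre_curvature I
      (\<lambda>t. frame_vector \<gamma> \<nu> (1 + (s t)\<^sup>2 / 2) (\<sigma> * (s t)\<^sup>2 / 2) (s t) t)
      (\<lambda>t. frame_vector \<gamma> \<nu> (- s t) (- \<sigma> * s t) (-1) t)
      (\<lambda>t. - s t * (n t + \<sigma> * m t)) (\<lambda>t. n t + \<sigma> * m t)"
  \<comment> \<open>The placeholders are the eight smoothness and four normalization conditions.
    With the six coordinate equations they remain as goals; all but the smoothness conditions are
    algebra in \<open>s\<close>, \<open>m\<close>, \<open>n\<close> for each sign.\<close>
  proof (rule legendre_curvature_frame_vector[where dz = s' and dz' = "\<lambda>t. 0",
        OF curv nontriv _ _ _ _ _ _ _ _ _ _ _ _ d(1,2) ds d(3,4,5)])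
  qed (use sm \<sigma> in \<open>auto intro!: smooth_on_intros add_pos_nonneg
      simp: s'_def power2_eq_square field_simps\<close>)
  then show ?thesis
    by (simp add: horocyclic_involute_frame_vector[abs_def] involute_normal_frame_vector[abs_def])
qed

text \<open>Put \<open>L = \<gamma> + \<sigma> \<nu>\<close>. The involute plus
  \<open>\<sigma>\<close> times its third frame vector is again \<open>L\<close>, and its normal is
  \<open>- (\<mu> + s L)\<close>. The evolute with parameter \<open>f\<close> is thus
  \<open>\<gamma> + (s - f) \<mu> + (s - f)^2 / 2 L\<close>.\<close>

lemma horocyclic_evolute_involute:
  assumes "(\<gamma> t, \<nu> t) \<in> Delta1" "\<sigma> \<in> {1, -1}" "f t = s t"
  shows "horocyclic_evolute \<sigma> (horocyclic_involute \<sigma> \<gamma> \<nu> s) (involute_normal \<sigma> \<gamma> \<nu> s) f t = \<gamma> t"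
proof -
  have "horocyclic_evolute \<sigma> (horocyclic_involute \<sigma> \<gamma> \<nu> s) (involute_normal \<sigma> \<gamma> \<nu> s) f t
      = frame_vector \<gamma> \<nu> 1 0 0 t"
    unfolding horocyclic_evolute_def third_frame_def[of "horocyclic_involute \<sigma> \<gamma> \<nu> s"]
      horocyclic_involute_frame_vector involute_normal_frame_vector
      frame_vector_wedge[of \<gamma> t \<nu>, OF assms(1)] frame_vector_scaleR frame_vector_add
    using assms(2,3) by (intro arg_cong4[where f = "\<lambda>x y z. frame_vector \<gamma> \<nu> x y z"])
      (auto simp: power2_eq_square field_simps)
  then show ?thesis by (simp add: frame_vector_def)
qed

text \<open>The inner product of the derivative of the evolute with \<open>evolute_normal\<close> is
  \<open>m + f * n\<close>, which vanishes by the choice of \<open>f\<close>. The derivative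
  \<open>f'\<close> is a parameter because it enters the curvature, which must itself be
  smooth.\<close>

lemma legendre_curvature_evolute:
  assumes curv: "legendre_curvature I \<gamma> \<nu> m n" and "\<sigma> \<in> {1, -1}"
    and nontriv: "\<And>t. t \<in> I \<Longrightarrow> at t within I \<noteq> bot"
    and f: "smooth_on I f" "\<And>t. t \<in> I \<Longrightarrow> m t + f t * n t = 0"
    and f': "smooth_on I f'" "\<And>t. t \<in> I \<Longrightarrow> (f has_real_derivative f' t) (at t within I)"
  shows "legendre_curvature I (horocyclic_evolute \<sigma> \<gamma> \<nu> f) (evolute_normal \<sigma> \<gamma> \<nu> f)
    (\<lambda>t. - f' t + \<sigma> * (f t)\<^sup>2 * n t / 2) (\<lambda>t. \<sigma> * f' t - (f t)\<^sup>2 * n t / 2 + n t)"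
proof -
  have sm: "smooth_on I m" "smooth_on I n"
    using curv by (auto simp: legendre_curvature_def)
  have m: "m t = - f t * n t" if "t \<in> I" for t
    using f(2)[OF that] by simp
  have d: "((\<lambda>t. 1 + (f t)\<^sup>2 / 2) has_real_derivative f t * f' t) (at t within I)"
    "((\<lambda>t. \<sigma> * (f t)\<^sup>2 / 2) has_real_derivative \<sigma> * f t * f' t) (at t within I)"
    "((\<lambda>t. - \<sigma> * (f t)\<^sup>2 / 2) has_real_derivative - \<sigma> * f t * f' t) (at t within I)"
    "((\<lambda>t. - \<sigma> * f t) has_real_derivative - \<sigma> * f' t) (at t within I)"
    "((\<lambda>t. 1 - (f t)\<^sup>2 / 2) has_real_derivative - f t * f' t) (at t within I)" if "t \<in> I" for t
    using f'(2)[OF that] by (auto intro!: derivative_eq_intros)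
  have \<sigma>: "\<sigma> = 1 \<or> \<sigma> = -1" using assms(2) by auto
  have "legendre_curvature I
      (\<lambda>t. frame_vector \<gamma> \<nu> (1 + (f t)\<^sup>2 / 2) (f t) (\<sigma> * (f t)\<^sup>2 / 2) t)
      (\<lambda>t. frame_vector \<gamma> \<nu> (- \<sigma> * (f t)\<^sup>2 / 2) (- \<sigma> * f t) (1 - (f t)\<^sup>2 / 2) t)
      (\<lambda>t. - f' t + \<sigma> * (f t)\<^sup>2 * n t / 2) (\<lambda>t. \<sigma> * f' t - (f t)\<^sup>2 * n t / 2 + n t)"
  proof (rule legendre_curvature_frame_vector[where dy = f',
        OF curv nontriv _ _ _ _ _ _ _ _ _ _ _ _ d(1) f'(2) d(2,3,4,5)])
  qed (use sm f(1) f'(1) \<sigma> in \<open>auto intro!: smooth_on_intros add_pos_nonneg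
      simp: m power2_eq_square field_simps\<close>)
  then show ?thesis
    by (simp add: horocyclic_evolute_frame_vector[abs_def] evolute_normal_frame_vector[abs_def])
qed

text \<open>Put \<open>L = \<gamma> + \<sigma> \<mu>\<close>. The evolute plus
  \<open>\<sigma>\<close> times its normal is again \<open>L\<close>, and its third frame vector is
  \<open>- (\<nu> + f L)\<close>. Moving by \<open>S\<close> therefore undoes part of the motion by
  \<open>f\<close>.\<close>

lemma horocyclic_involute_evolute:
  assumes "(\<gamma> t, \<nu> t) \<in> Delta1" "\<sigma> \<in> {1, -1}"
  shows "horocyclic_involute \<sigma> (horocyclic_evolute \<sigma> \<gamma> \<nu> f) (evolute_normal \<sigma> \<gamma> \<nu> f) S t
    = \<gamma> t + (f t - S t) *\<^sub>R \<nu> t + ((f t - S t)\<^sup>2 / 2) *\<^sub>R (\<gamma> t + \<sigma> *\<^sub>R third_frame \<gamma> \<nu> t)"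
proof -
  have "horocyclic_involute \<sigma> (horocyclic_evolute \<sigma> \<gamma> \<nu> f) (evolute_normal \<sigma> \<gamma> \<nu> f) S t
      = frame_vector \<gamma> \<nu> (1 + (f t - S t)\<^sup>2 / 2) (f t - S t) (\<sigma> * (f t - S t)\<^sup>2 / 2) t"
    unfolding horocyclic_involute_def third_frame_def[of "horocyclic_evolute \<sigma> \<gamma> \<nu> f"]
      horocyclic_evolute_frame_vector evolute_normal_frame_vector
      frame_vector_wedge[of \<gamma> t \<nu>, OF assms(1)] frame_vector_scaleR frame_vector_add
    using assms(2) by (intro arg_cong4[where f = "\<lambda>x y z. frame_vector \<gamma> \<nu> x y z"])
      (auto simp: power2_eq_square field_simps)
  then show ?thesis by (simp add: frame_vector_def algebra_simps)
qed

section \<open>The equation of horocyclic parallels\<close>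

text \<open>Integrating factor: \<open>w * exp (- A)\<close> is constant when \<open>A\<close> is an
  antiderivative of \<open>a\<close>.\<close>

lemma linear_ode_zero:
  fixes w a :: "real \<Rightarrow> real"
  assumes "is_interval I" "continuous_on I a"
    and w: "\<And>t. t \<in> I \<Longrightarrow> (w has_real_derivative a t * w t) (at t within I)"
    and "t0 \<in> I" "w t0 = 0" "t \<in> I"
  shows "w t = 0"
proof -
  \<comment> \<open>The compact interval spanned by \<open>t0\<close> and \<open>t\<close> supplies
    a base point for the integral and lies in \<open>I\<close>, whatever the endpoints of
    \<open>I\<close> are.\<close>
  define J where "J = {min t0 t..max t0 t}"
  have sub: "J \<subseteq> I"
    using assms(1,4,6) mem_is_interval_1_I[of I "min t0 t" "max t0 t"]
    by (auto simp: J_def min_def max_def split: if_splits)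
  define A where "A = (\<lambda>u. integral {min t0 t..u} a)"
  have A: "(A has_real_derivative a u) (at u within J)" if "u \<in> J" for u
    unfolding A_def J_def has_real_derivative_iff_has_vector_derivative
    using that sub continuous_on_subset[OF assms(2)]
    by (intro integral_has_vector_derivative) (auto simp: J_def)
  have "((\<lambda>u. w u * exp (- A u)) has_real_derivative 0) (at u within J)" if "u \<in> J" for u
    using A[OF that] DERIV_subset[OF w sub, of u] that sub
    by (auto intro!: derivative_eq_intros simp: subset_iff)
  then obtain c where c: "\<And>u. u \<in> J \<Longrightarrow> w u * exp (- A u) = c"
    using has_field_derivative_zero_constant[of J "\<lambda>u. w u * exp (- A u)"]
    by (auto simp: J_def)
  from c[of t0] c[of t] show ?thesis
    using assms(5) by (auto simp: J_def)
qed

text \<open>Bernoulli's equation becomes linear in the reciprocal of the unknown.  Multiplying out,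
  the difference of both sides of \<open>l * (\<sigma> * N + c) = 2 * exp (- \<sigma> * M)\<close> solves a homogeneous
  linear equation, so that an identity at one point holds everywhere, and \<open>l\<close> has no zero
  unless it vanishes identically.\<close>

lemma parallel_ode_iff:
  fixes l m n M N :: "real \<Rightarrow> real"
  assumes I: "is_interval I" and \<sigma>: "\<sigma> \<in> {1, -1}"
    and cont: "continuous_on I m" "continuous_on I n"
    and M: "\<And>t. t \<in> I \<Longrightarrow> (M has_real_derivative m t) (at t within I)"
    and N: "\<And>t. t \<in> I \<Longrightarrow> (N has_real_derivative n t * exp (- \<sigma> * M t)) (at t within I)"
  shows "(\<forall>t\<in>I. (l has_real_derivative - \<sigma> * ((l t)\<^sup>2 * n t / 2 + l t * m t)) (at t within I)) \<longleftrightarrow>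
    (\<forall>t\<in>I. l t = 0) \<or>
    (\<exists>c. \<forall>t\<in>I. \<sigma> * N t + c \<noteq> 0 \<and> l t = 2 * exp (- \<sigma> * M t) / (\<sigma> * N t + c))"
    (is "?ode \<longleftrightarrow> ?zero \<or> ?formula")
proof
  assume ode: ?ode
  show "?zero \<or> ?formula"
  proof (cases ?zero)
    case False
    then obtain t0 where t0: "t0 \<in> I" "l t0 \<noteq> 0" by blast
    \<comment> \<open>The only constant for which the claimed identity holds at
      \<open>t0\<close>.\<close>
    define c where "c = 2 * exp (- \<sigma> * M t0) / l t0 - \<sigma> * N t0"
    define w where "w = (\<lambda>t. l t * (\<sigma> * N t + c) - 2 * exp (- \<sigma> * M t))"
    \<comment> \<open>The common factor that appears when the derivative of \<open>w\<close> is
      rewritten with the equation for \<open>l\<close>.\<close>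
    define a where "a = (\<lambda>t. - (\<sigma> * m t + \<sigma> * l t * n t / 2))"
    have "continuous_on I l"
      using ode by (meson DERIV_continuous continuous_on_eq_continuous_within)
    then have "continuous_on I a"
      unfolding a_def using cont by (intro continuous_intros) auto
    moreover have "(w has_real_derivative a t * w t) (at t within I)" if "t \<in> I" for t
    proof -
      have "(w has_real_derivative
          - \<sigma> * ((l t)\<^sup>2 * n t / 2 + l t * m t) * (\<sigma> * N t + c)
            + l t * (\<sigma> * (n t * exp (- \<sigma> * M t))) - 2 * (exp (- \<sigma> * M t) * (- \<sigma> * m t))) (at t within I)"
        unfolding w_def using M[OF that] N[OF that] ode that
        by (auto intro!: derivative_eq_intros)
      moreover have "- \<sigma> * ((l t)\<^sup>2 * n t / 2 + l t * m t) * (\<sigma> * N t + c)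
            + l t * (\<sigma> * (n t * exp (- \<sigma> * M t))) - 2 * (exp (- \<sigma> * M t) * (- \<sigma> * m t)) = a t * w t"
        by (simp add: a_def w_def power2_eq_square field_simps)
      ultimately show ?thesis by simp
    qed
    moreover have "w t0 = 0"
      using t0 by (simp add: w_def c_def)
    ultimately have w: "w t = 0" if "t \<in> I" for t
      using linear_ode_zero[OF I _ _ t0(1)] that by blast
    have "\<sigma> * N t + c \<noteq> 0 \<and> l t = 2 * exp (- \<sigma> * M t) / (\<sigma> * N t + c)" if "t \<in> I" for t
    proof -
      have eq: "l t * (\<sigma> * N t + c) = 2 * exp (- \<sigma> * M t)"
        using w[OF that] by (simp add: w_def)
      \<comment> \<open>The right-hand side of \<open>eq\<close> never vanishes, so neither does a
        factor on the left.\<close>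
      then have "\<sigma> * N t + c \<noteq> 0"
        by (metis exp_not_eq_zero mult_eq_0_iff zero_neq_numeral)
      with eq show ?thesis by (simp add: field_simps)
    qed
    then show ?thesis by blast
  qed blast
next
  assume "?zero \<or> ?formula"
  then show ?ode
  proof
    assume zero: ?zero
    show ?ode
    proof
      fix t assume t: "t \<in> I"
      show "(l has_real_derivative - \<sigma> * ((l t)\<^sup>2 * n t / 2 + l t * m t)) (at t within I)"
        by (rule has_field_derivative_transform_within[where f = "\<lambda>t. 0" and d = 1])
           (use zero t in auto)
    qed
  next
    assume ?formula
    then obtain c where c: "\<And>t. t \<in> I \<Longrightarrow> \<sigma> * N t + c \<noteq> 0"
        "\<And>t. t \<in> I \<Longrightarrow> l t = 2 * exp (- \<sigma> * M t) / (\<sigma> * N t + c)"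
      by blast
    show ?ode
    proof
      fix t assume t: "t \<in> I"
      let ?K = "\<sigma> * N t + c" and ?e = "exp (- \<sigma> * M t)"
      have "((\<lambda>t. 2 * exp (- \<sigma> * M t) / (\<sigma> * N t + c)) has_real_derivative
          (2 * (?e * (- \<sigma> * m t)) * ?K - 2 * ?e * (\<sigma> * (n t * ?e))) / (?K * ?K)) (at t within I)"
        using M[OF t] N[OF t] c(1)[OF t] by (auto intro!: derivative_eq_intros)
      moreover have "(2 * (e * (- \<sigma> * m t)) * K - 2 * e * (\<sigma> * (n t * e))) / (K * K)
          = - \<sigma> * ((2 * e / K)\<^sup>2 * n t / 2 + (2 * e / K) * m t)" if "K \<noteq> 0" for e K :: real
        using that by (simp add: power2_eq_square field_simps)
      ultimately have "((\<lambda>t. 2 * exp (- \<sigma> * M t) / (\<sigma> * N t + c)) has_real_derivative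
          - \<sigma> * ((l t)\<^sup>2 * n t / 2 + l t * m t)) (at t within I)"
        using c[OF t] by simp
      then show "(l has_real_derivative - \<sigma> * ((l t)\<^sup>2 * n t / 2 + l t * m t)) (at t within I)"
        by (rule has_field_derivative_transform_within[where d = 1]) (use c t in auto)
    qed
  qed
qed

text \<open>The substitution \<open>l = f - S\<close> turns the Riccati equation of the involutes of the evolute
  into the equation of the parallels.\<close>

lemma riccati_evolute_iff:
  assumes f: "smooth_on I f" "\<And>t. t \<in> I \<Longrightarrow> m t + f t * n t = 0"
    and f': "\<And>t. t \<in> I \<Longrightarrow> (f has_real_derivative f' t) (at t within I)"
    and \<sigma>: "\<sigma> \<in> {1, -1}"
  shows "riccati_solution \<sigma> I (\<lambda>t. - f' t + \<sigma> * (f t)\<^sup>2 * n t / 2)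
      (\<lambda>t. \<sigma> * f' t - (f t)\<^sup>2 * n t / 2 + n t) S \<longleftrightarrow>
    smooth_on I (\<lambda>t. f t - S t) \<and> (\<forall>t\<in>I. ((\<lambda>t. f t - S t) has_real_derivative
      - \<sigma> * ((f t - S t)\<^sup>2 * n t / 2 + (f t - S t) * m t)) (at t within I))"
    (is "_ \<longleftrightarrow> _ \<and> (\<forall>t\<in>I. (_ has_real_derivative ?r t) _)")
proof -
  have smooth: "smooth_on I S \<longleftrightarrow> smooth_on I (\<lambda>t. f t - S t)"
    using smooth_on_diff[OF f(1), of S] smooth_on_diff[OF f(1), of "\<lambda>t. f t - S t"] by auto
  \<comment> \<open>The combination of curvatures in the quadratic term collapses to
    \<open>\<sigma> * n\<close>, so the right-hand side is
    \<open>f' + \<sigma> * n * (S^2 - f^2) / 2\<close>; the factor \<open>S - f\<close> is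
    visible.\<close>
  have rhs: "(- f' t + \<sigma> * (f t)\<^sup>2 * n t / 2 + \<sigma> * (\<sigma> * f' t - (f t)\<^sup>2 * n t / 2 + n t)) / 2 * (S t)\<^sup>2
      - (- f' t + \<sigma> * (f t)\<^sup>2 * n t / 2) = f' t - ?r t" if "t \<in> I" for t
  proof -
    have m: "m t = - f t * n t" using f(2)[OF that] by simp
    show ?thesis using \<sigma> by (auto simp: m power2_eq_square field_simps)
  qed
  have key: "(S has_real_derivative f' t - r) (at t within I) \<longleftrightarrow>
      ((\<lambda>t. f t - S t) has_real_derivative r) (at t within I)" if "t \<in> I" for t r
    using DERIV_diff[OF f'[OF that], of S "f' t - r"]
      DERIV_diff[OF f'[OF that], of "\<lambda>t. f t - S t" r] by auto
  show ?thesis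
    unfolding riccati_solution_def smooth
    by (intro conj_cong ball_cong refl) (simp only: rhs key)
qed

section \<open>Evolutes of involutes and involutes of evolutes\<close>

text \<open>The agreement set is closed relative to \<open>I\<close>, hence the trace on
  \<open>I\<close> of a closed set \<open>T\<close>; \<open>T\<close> contains \<open>D\<close> and
  therefore its closure.\<close>

lemma equal_on_dense:
  fixes f g :: "'a::topological_space \<Rightarrow> real"
  assumes "continuous_on I f" "continuous_on I g" "I \<subseteq> closure D"
    and "\<And>t. t \<in> D \<Longrightarrow> t \<in> I \<and> f t = g t" and "t \<in> I"
  shows "f t = g t"
proof -
  have "closedin (top_of_set I) {t \<in> I. f t - g t = 0}"
    using assms(1,2) by (intro continuous_closedin_preimage_constant continuous_intros)
  then obtain T where T: "closed T" "{t \<in> I. f t - g t = 0} = I \<inter> T"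
    by (auto simp: closedin_closed)
  have "D \<subseteq> T" using T(2) assms(4) by auto
  then have "t \<in> T"
    using assms(3,5) closure_minimal[OF _ T(1)] by blast
  then show ?thesis using T(2) assms(5) by auto
qed

text \<open>A single equivalence serves both claims: \<open>s\<close> itself gives existence, and
  any other evolute function agrees with \<open>s\<close> on \<open>I\<close>.\<close>

lemma evolute_of_involute:
  assumes curv: "legendre_curvature I \<gamma> \<nu> m n" and \<sigma>: "\<sigma> \<in> {1, -1}"
    and nontriv: "\<And>t. t \<in> I \<Longrightarrow> at t within I \<noteq> bot"
    and s: "riccati_solution \<sigma> I m n s" and dense: "I \<subseteq> closure {t \<in> I. n t + \<sigma> * m t \<noteq> 0}"
  shows "evolute_function I (horocyclic_involute \<sigma> \<gamma> \<nu> s) (involute_normal \<sigma> \<gamma> \<nu> s) f \<longleftrightarrow>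
    smooth_on I f \<and> (\<forall>t\<in>I. f t = s t)"
proof -
  have sm: "smooth_on I s" using s by (simp add: riccati_solution_def)
  have "(\<forall>t\<in>I. - s t * (n t + \<sigma> * m t) + f t * (n t + \<sigma> * m t) = 0) \<longleftrightarrow> (\<forall>t\<in>I. f t = s t)"
    if "smooth_on I f"
  proof
    assume eq: "\<forall>t\<in>I. - s t * (n t + \<sigma> * m t) + f t * (n t + \<sigma> * m t) = 0"
    show "\<forall>t\<in>I. f t = s t"
    proof
      fix t assume "t \<in> I"
      then show "f t = s t"
        by (rule equal_on_dense[OF smooth_on_continuous_on[OF that] smooth_on_continuous_on[OF sm] dense, rotated])
           (use eq in auto)
    qed
  qed simp
  then show ?thesis
    using evolute_function_iff[OF legendre_curvature_involute[OF curv \<sigma> nontriv s] nontriv, of f]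
    by auto
qed

theorem theorem4p15:
  fixes I :: "real set" and \<gamma> \<nu> :: "real \<Rightarrow> real^3" and m n :: "real \<Rightarrow> real"
  assumes "is_interval I" and "interior I \<noteq> {}"
    and "legendre_curvature I \<gamma> \<nu> m n"
    and "I \<subseteq> closure {t \<in> I. n t \<noteq> 0}"
  shows
    "(\<forall>\<sigma>\<in>{1, -1}. \<forall>s. riccati_solution \<sigma> I m n s \<and> I \<subseteq> closure {t \<in> I. n t + \<sigma> * m t \<noteq> 0} \<longrightarrow>
        (let J = horocyclic_involute \<sigma> \<gamma> \<nu> s; \<nu>J = involute_normal \<sigma> \<gamma> \<nu> s in
           (\<exists>f. evolute_function I J \<nu>J f) \<and>
           (\<forall>f g. evolute_function I J \<nu>J f \<and> evolute_function I J \<nu>J g \<longrightarrow> (\<forall>t\<in>I. f t = g t)) \<and>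
           (\<forall>f. evolute_function I J \<nu>J f \<longrightarrow> (\<forall>t\<in>I. horocyclic_evolute \<sigma> J \<nu>J f t = \<gamma> t)) \<and>
           (\<exists>f. evolute_function I J (\<lambda>t. - \<nu>J t) f) \<and>
           (\<forall>f. evolute_function I J (\<lambda>t. - \<nu>J t) f \<longrightarrow>
              (\<forall>t\<in>I. horocyclic_evolute (- \<sigma>) J (\<lambda>t. - \<nu>J t) f t = \<gamma> t)))) \<and>
     (\<forall>f. smooth_on I f \<and> (\<forall>t\<in>I. m t + f t * n t = 0) \<longrightarrow>
        (\<forall>\<sigma>\<in>{1, -1}.
          (let E = horocyclic_evolute \<sigma> \<gamma> \<nu> f; \<nu>E = evolute_normal \<sigma> \<gamma> \<nu> f in
             (\<forall>S. involute_function \<sigma> I E \<nu>E S \<longrightarrow>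
                (\<forall>t\<in>I. horocyclic_involute \<sigma> E \<nu>E S t =
                          horocyclic_involute (- \<sigma>) E (\<lambda>t. - \<nu>E t) (\<lambda>t. - S t) t \<and>
                        horocyclic_involute \<sigma> E \<nu>E S t =
                          \<gamma> t + (f t - S t) *\<^sub>R \<nu> t
                            + ((f t - S t)\<^sup>2 / 2) *\<^sub>R (\<gamma> t + \<sigma> *\<^sub>R third_frame \<gamma> \<nu> t)) \<and>
                is_horocyclic_parallel \<sigma> I \<gamma> \<nu> (horocyclic_involute \<sigma> E \<nu>E S) \<and>
                is_horocyclic_parallel \<sigma> I \<gamma> \<nu>
                  (horocyclic_involute (- \<sigma>) E (\<lambda>t. - \<nu>E t) (\<lambda>t. - S t))) \<and>
             (\<forall>M N. (\<forall>t\<in>I. (M has_real_derivative m t) (at t within I)) \<and>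
                     (\<forall>t\<in>I. (N has_real_derivative n t * exp (- \<sigma> * M t)) (at t within I)) \<longrightarrow>
                (\<forall>S. involute_function \<sigma> I E \<nu>E S \<longleftrightarrow>
                   (\<forall>t\<in>I. S t = f t) \<or>
                   (\<exists>c. \<forall>t\<in>I. \<sigma> * N t + c \<noteq> 0 \<and>
                          S t = f t - 2 * exp (- \<sigma> * M t) / (\<sigma> * N t + c)))) \<and>
             (\<forall>S'. involute_function (- \<sigma>) I E (\<lambda>t. - \<nu>E t) S' \<longleftrightarrow>
                (\<exists>S. involute_function \<sigma> I E \<nu>E S \<and> (\<forall>t\<in>I. S' t = - S t))))))"
    (is "?involutes \<and> ?evolutes")
proof (rule conjI)
  have nontriv: "at t within I \<noteq> bot" if "t \<in> I" for t
    using assms(1,2) that by (rule at_within_interval_neq_bot)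
  note curv = assms(3)
  have D: "(\<gamma> t, \<nu> t) \<in> Delta1" if "t \<in> I" for t
    using curv that by (rule legendre_curvature_Delta1)
  have sm: "smooth_on I m" "smooth_on I n"
    using curv by (auto simp: legendre_curvature_def)
  show ?involutes
  proof (intro ballI allI impI)
    fix \<sigma> s
    assume \<sigma>: "\<sigma> \<in> {1, -1 :: real}"
      and "riccati_solution \<sigma> I m n s \<and> I \<subseteq> closure {t \<in> I. n t + \<sigma> * m t \<noteq> 0}"
    then have s: "riccati_solution \<sigma> I m n s"
      and dense: "I \<subseteq> closure {t \<in> I. n t + \<sigma> * m t \<noteq> 0}"
      by auto
    define J where "J = horocyclic_involute \<sigma> \<gamma> \<nu> s"
    define \<nu>J where "\<nu>J = involute_normal \<sigma> \<gamma> \<nu> s"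
    have evolute_iff: "evolute_function I J \<nu>J f \<longleftrightarrow> smooth_on I f \<and> (\<forall>t\<in>I. f t = s t)" for f
      unfolding J_def \<nu>J_def using curv \<sigma> nontriv s dense by (rule evolute_of_involute)
    have ex: "evolute_function I J \<nu>J s"
      using s by (simp add: evolute_iff riccati_solution_def)
    have evolute: "horocyclic_evolute \<sigma> J \<nu>J f t = \<gamma> t" if "evolute_function I J \<nu>J f" "t \<in> I" for f t
      unfolding J_def \<nu>J_def using that
      by (intro horocyclic_evolute_involute D \<sigma>) (auto simp: evolute_iff)
    \<comment> \<open>Reversing the normal once more turns \<open>f\<close> into the evolute
      function \<open>- f\<close> of the original normal, to which \<open>evolute\<close>
      applies.\<close>
    have "horocyclic_evolute (- \<sigma>) J (\<lambda>t. - \<nu>J t) f t = \<gamma> t"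
      if "evolute_function I J (\<lambda>t. - \<nu>J t) f" "t \<in> I" for f t
      using evolute[of "\<lambda>t. - f t" t] evolute_function_minus[OF that(1)] that(2)
      by (simp add: horocyclic_evolute_minus)
    then show "let J = horocyclic_involute \<sigma> \<gamma> \<nu> s; \<nu>J = involute_normal \<sigma> \<gamma> \<nu> s in
           (\<exists>f. evolute_function I J \<nu>J f) \<and>
           (\<forall>f g. evolute_function I J \<nu>J f \<and> evolute_function I J \<nu>J g \<longrightarrow> (\<forall>t\<in>I. f t = g t)) \<and>
           (\<forall>f. evolute_function I J \<nu>J f \<longrightarrow> (\<forall>t\<in>I. horocyclic_evolute \<sigma> J \<nu>J f t = \<gamma> t)) \<and>
           (\<exists>f. evolute_function I J (\<lambda>t. - \<nu>J t) f) \<and>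
           (\<forall>f. evolute_function I J (\<lambda>t. - \<nu>J t) f \<longrightarrow>
              (\<forall>t\<in>I. horocyclic_evolute (- \<sigma>) J (\<lambda>t. - \<nu>J t) f t = \<gamma> t))"
      unfolding Let_def J_def[symmetric] \<nu>J_def[symmetric]
    proof (intro conjI)
      show "\<exists>f. evolute_function I J \<nu>J f" using ex by blast
      show "\<exists>f. evolute_function I J (\<lambda>t. - \<nu>J t) f"
        using evolute_function_minus[OF ex] by blast
    qed (auto simp: evolute evolute_iff[THEN iffD1])
  qed
  show ?evolutes
  proof (intro ballI allI impI)
    fix f :: "real \<Rightarrow> real" and \<sigma> :: real
    assume "smooth_on I f \<and> (\<forall>t\<in>I. m t + f t * n t = 0)" and \<sigma>: "\<sigma> \<in> {1, -1}"
    then have f: "smooth_on I f" "\<And>t. t \<in> I \<Longrightarrow> m t + f t * n t = 0"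
      by auto
    obtain f' where f': "smooth_on I f'" "\<And>t. t \<in> I \<Longrightarrow> (f has_real_derivative f' t) (at t within I)"
      using smooth_on_derivative[OF f(1)] by (auto simp: has_real_derivative_iff_has_vector_derivative)
    define E where "E = horocyclic_evolute \<sigma> \<gamma> \<nu> f"
    define \<nu>E where "\<nu>E = evolute_normal \<sigma> \<gamma> \<nu> f"
    define ode where "ode = (\<lambda>l. \<forall>t\<in>I. (l has_real_derivative
      - \<sigma> * ((l t)\<^sup>2 * n t / 2 + l t * m t)) (at t within I))"
    have involute_iff: "involute_function \<sigma> I E \<nu>E S \<longleftrightarrow>
        smooth_on I (\<lambda>t. f t - S t) \<and> ode (\<lambda>t. f t - S t)" for S
      unfolding E_def \<nu>E_def ode_def
      using involute_function_iff[OF legendre_curvature_evolute[OF curv \<sigma> nontriv f f'] nontriv]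
        riccati_evolute_iff[OF f f'(2) \<sigma>] by simp
    have formula: "horocyclic_involute \<sigma> E \<nu>E S t = \<gamma> t + (f t - S t) *\<^sub>R \<nu> t
        + ((f t - S t)\<^sup>2 / 2) *\<^sub>R (\<gamma> t + \<sigma> *\<^sub>R third_frame \<gamma> \<nu> t)" if "t \<in> I" for S t
      unfolding E_def \<nu>E_def using D[OF that] \<sigma> by (rule horocyclic_involute_evolute)
    have flip: "horocyclic_involute (- \<sigma>) E (\<lambda>t. - \<nu>E t) (\<lambda>t. - S t) = horocyclic_involute \<sigma> E \<nu>E S" for S
      by (rule ext) (rule horocyclic_involute_minus)
    \<comment> \<open>The same \<open>f - S\<close> is the parameter displayed in
      \<open>formula\<close> and the solution required by \<open>ode\<close>.\<close>
    have parallel: "is_horocyclic_parallel \<sigma> I \<gamma> \<nu> (horocyclic_involute \<sigma> E \<nu>E S)"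
      if "involute_function \<sigma> I E \<nu>E S" for S
      unfolding is_horocyclic_parallel_def
      by (rule exI[of _ m], rule exI[of _ n], rule exI[of _ "\<lambda>t. f t - S t"])
         (use that curv formula in \<open>auto simp: involute_iff ode_def\<close>)
    have solutions: "involute_function \<sigma> I E \<nu>E S \<longleftrightarrow> (\<forall>t\<in>I. S t = f t) \<or>
        (\<exists>c. \<forall>t\<in>I. \<sigma> * N t + c \<noteq> 0 \<and> S t = f t - 2 * exp (- \<sigma> * M t) / (\<sigma> * N t + c))"
      if M: "\<forall>t\<in>I. (M has_real_derivative m t) (at t within I)"
        and N: "\<forall>t\<in>I. (N has_real_derivative n t * exp (- \<sigma> * M t)) (at t within I)" for M N S
    proof -
      have ode: "ode (\<lambda>t. f t - S t) \<longleftrightarrow> (\<forall>t\<in>I. S t = f t) \<or>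
        (\<exists>c. \<forall>t\<in>I. \<sigma> * N t + c \<noteq> 0 \<and> S t = f t - 2 * exp (- \<sigma> * M t) / (\<sigma> * N t + c))"
      proof -
        have "f t - S t = 0 \<longleftrightarrow> S t = f t" "f t - S t = x \<longleftrightarrow> S t = f t - x" for t x
          by auto
        with parallel_ode_iff[OF assms(1) \<sigma> smooth_on_continuous_on[OF sm(1)]
            smooth_on_continuous_on[OF sm(2)], of M N "\<lambda>t. f t - S t"] M N
        show ?thesis
          unfolding ode_def by (simp only:)
      qed
      \<comment> \<open>An involute function must be smooth, whereas \<open>M\<close> and
        \<open>N\<close> come only with first derivatives. Smoothness passes from \<open>m\<close>
        to \<open>M\<close>, then to the derivative of \<open>N\<close> and to \<open>N\<close>, and
        so to the closed form of \<open>f - S\<close>.\<close>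
      have smM: "smooth_on I M"
        using sm(1) by (rule smooth_on_if_derivative)
          (use M in \<open>simp add: has_real_derivative_iff_has_vector_derivative\<close>)
      have smN: "smooth_on I N"
      proof (rule smooth_on_if_derivative)
        show "smooth_on I (\<lambda>t. n t * exp (- \<sigma> * M t))"
          using sm smM by (intro smooth_on_intros)
      qed (use N in \<open>simp add: has_real_derivative_iff_has_vector_derivative\<close>)
      have "smooth_on I (\<lambda>t. f t - S t)" if "ode (\<lambda>t. f t - S t)"
        using that unfolding ode
      proof
        assume "\<forall>t\<in>I. S t = f t"
        then show ?thesis
          by (intro smooth_on_cong[OF smooth_on_const[of I 0]]) auto
      next
        assume "\<exists>c. \<forall>t\<in>I. \<sigma> * N t + c \<noteq> 0 \<and> S t = f t - 2 * exp (- \<sigma> * M t) / (\<sigma> * N t + c)"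
        then obtain c where c: "\<And>t. t \<in> I \<Longrightarrow> \<sigma> * N t + c \<noteq> 0"
            "\<And>t. t \<in> I \<Longrightarrow> S t = f t - 2 * exp (- \<sigma> * M t) / (\<sigma> * N t + c)"
          by blast
        have "smooth_on I (\<lambda>t. 2 * exp (- \<sigma> * M t) / (\<sigma> * N t + c))"
          using smM smN c(1) by (intro smooth_on_divide smooth_on_intros)
        then show ?thesis
          by (rule smooth_on_cong) (simp add: c(2))
      qed
      then show ?thesis
        unfolding involute_iff ode[symmetric] by blast
    qed
    have minus: "involute_function (- \<sigma>) I E (\<lambda>t. - \<nu>E t) S' \<longleftrightarrow>
        (\<exists>S. involute_function \<sigma> I E \<nu>E S \<and> (\<forall>t\<in>I. S' t = - S t))" for S'
    proof
      assume "involute_function (- \<sigma>) I E (\<lambda>t. - \<nu>E t) S'"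
      then have "involute_function \<sigma> I E \<nu>E (\<lambda>t. - S' t)"
        using involute_function_minus[of "- \<sigma>" I E "\<lambda>t. - \<nu>E t" S'] by simp
      then show "\<exists>S. involute_function \<sigma> I E \<nu>E S \<and> (\<forall>t\<in>I. S' t = - S t)"
        by (intro exI[of _ "\<lambda>t. - S' t"]) simp
    next
      assume "\<exists>S. involute_function \<sigma> I E \<nu>E S \<and> (\<forall>t\<in>I. S' t = - S t)"
      then obtain S where S: "involute_function \<sigma> I E \<nu>E S" "\<And>t. t \<in> I \<Longrightarrow> S' t = - S t"
        by blast
      \<comment> \<open>\<open>S'\<close> equals \<open>- S\<close> only on \<open>I\<close>, so the
        two functions cannot be identified; the conditions are carried from \<open>S\<close> to
        \<open>- S'\<close> pointwise on \<open>I\<close>.\<close>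
      have "involute_function \<sigma> I E \<nu>E (\<lambda>t. - S' t)"
        unfolding involute_iff ode_def
      proof (intro conjI ballI)
        show "smooth_on I (\<lambda>t. f t - - S' t)"
          by (rule smooth_on_cong[of I "\<lambda>t. f t - S t"]) (use S in \<open>auto simp: involute_iff\<close>)
        fix t assume t: "t \<in> I"
        have "((\<lambda>t. f t - S t) has_real_derivative
            - \<sigma> * ((f t - S t)\<^sup>2 * n t / 2 + (f t - S t) * m t)) (at t within I)"
          using S(1) t by (simp add: involute_iff ode_def)
        then have "((\<lambda>t. f t - - S' t) has_real_derivative
            - \<sigma> * ((f t - S t)\<^sup>2 * n t / 2 + (f t - S t) * m t)) (at t within I)"
          by (rule has_field_derivative_transform_within[where d = 1]) (use S(2) t in auto)
        then show "((\<lambda>t. f t - - S' t) has_real_derivative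
            - \<sigma> * ((f t - - S' t)\<^sup>2 * n t / 2 + (f t - - S' t) * m t)) (at t within I)"
          by (simp add: S(2)[OF t])
      qed
      then show "involute_function (- \<sigma>) I E (\<lambda>t. - \<nu>E t) S'"
        using involute_function_minus by fastforce
    qed
    show "let E = horocyclic_evolute \<sigma> \<gamma> \<nu> f; \<nu>E = evolute_normal \<sigma> \<gamma> \<nu> f in
             (\<forall>S. involute_function \<sigma> I E \<nu>E S \<longrightarrow>
                (\<forall>t\<in>I. horocyclic_involute \<sigma> E \<nu>E S t =
                          horocyclic_involute (- \<sigma>) E (\<lambda>t. - \<nu>E t) (\<lambda>t. - S t) t \<and>
                        horocyclic_involute \<sigma> E \<nu>E S t =
                          \<gamma> t + (f t - S t) *\<^sub>R \<nu> t
                            + ((f t - S t)\<^sup>2 / 2) *\<^sub>R (\<gamma> t + \<sigma> *\<^sub>R third_frame \<gamma> \<nu> t)) \<and>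
                is_horocyclic_parallel \<sigma> I \<gamma> \<nu> (horocyclic_involute \<sigma> E \<nu>E S) \<and>
                is_horocyclic_parallel \<sigma> I \<gamma> \<nu>
                  (horocyclic_involute (- \<sigma>) E (\<lambda>t. - \<nu>E t) (\<lambda>t. - S t))) \<and>
             (\<forall>M N. (\<forall>t\<in>I. (M has_real_derivative m t) (at t within I)) \<and>
                     (\<forall>t\<in>I. (N has_real_derivative n t * exp (- \<sigma> * M t)) (at t within I)) \<longrightarrow>
                (\<forall>S. involute_function \<sigma> I E \<nu>E S \<longleftrightarrow>
                   (\<forall>t\<in>I. S t = f t) \<or>
                   (\<exists>c. \<forall>t\<in>I. \<sigma> * N t + c \<noteq> 0 \<and>
                          S t = f t - 2 * exp (- \<sigma> * M t) / (\<sigma> * N t + c)))) \<and>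
             (\<forall>S'. involute_function (- \<sigma>) I E (\<lambda>t. - \<nu>E t) S' \<longleftrightarrow>
                (\<exists>S. involute_function \<sigma> I E \<nu>E S \<and> (\<forall>t\<in>I. S' t = - S t)))"
      unfolding Let_def E_def[symmetric] \<nu>E_def[symmetric] flip
      using formula parallel solutions minus by (intro conjI allI impI ballI refl) blast+
  qed
qed

end
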